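(* Let $Z$ be a Polish space with at least two points and let $\sigma$ be the shift action of $\Gamma$ on $Z^\Gamma$, $(\gamma\cdot x)(\delta)=x(\delta\gamma)$. For a subshift $\Omega\subseteq\mathbb{N}^\Gamma$ the following are equivalent: (i) $\sigma$ admits a Baire measurable $\Omega$-coloring; (ii) $\Omega\supseteq\Omega'$ for some subshift $\Omega'$ with the join property; (iii) $\Omega$ is reducible to some local subshift $\Omega'$.
   Context: $\Gamma$ is a countably infinite discrete group with identity $\mathbf{1}$, equipped with a fixed proper right-invariant metric $\mathbf{dist}$ (balls of finite radius are finite); $\mathbf{Ball}(\gamma,r)$ is the closed ball, and $\mathbf{dist}(S,T)=\inf\{\mathbf{dist}(\gamma,\delta):\gamma\in S,\delta\in T\}$ with $\inf\emptyset=\infty$. $\mathbb{N}=\{0,1,\dots\}$ discrete; a subshift is a closed subset of $\mathbb{N}^\Gamma$ invariant under $(\gamma\cdot\omega)(\delta)=\omega(\delta\gamma)$. For a continuous action on a Polish space $X$ and $f:X\to\mathbb{N}$, $\pi_f(x)(\gamma)=f(\gamma\cdot x)$; a Baire measurable $\Omega$-coloring is a Baire measurable $f:X\to\mathbb{N}$ with $\pi_f^{-1}(\Omega)$ comeager. Let $F$ be the set of partial maps $\phi:\Gamma\rightharpoonup\mathbb{N}$ with finite domain; $\Gamma$ acts on $F$ by $\mathrm{dom}(\gamma\cdot\phi)=\{\delta\gamma^{-1}:\delta\in\mathrm{dom}(\phi)\}$, $(\gamma\cdot\phi)(\delta)=\phi(\delta\gamma)$. A $\Gamma$-ideal is a $\Gamma$-invariant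 $P\subseteq F$ closed under restrictions. For a subshift $\Omega$, $\mathrm{Fin}(\Omega)=\{\phi\in F:\phi\subseteq\omega$ for some $\omega\in\Omega\}$. A function $R:P\to[0,\infty)$ is invariant if $R(\gamma\cdot\phi)=R(\phi)$; $\phi,\psi$ are $R$-separated if $\mathbf{dist}(\mathrm{dom}\phi,\mathrm{dom}\psi)>R(\phi)+R(\psi)$. $P$ has the join property if there is an invariant $R:P\to[0,\infty)$ such that for all $k\in\mathbb{N}$ (including $k=0$, so $\emptyset\in P$) and pairwise $R$-separated $\phi_1,\dots,\phi_k\in P$, $\phi_1\cup\dots\cup\phi_k\in P$. For $r:\mathbb{N}\to[0,\infty)$, $\phi\in F$ is $r$-locally in $P$ if $\phi|_{\mathrm{dom}(\phi)\cap\mathbf{Ball}(\gamma,r(\phi(\gamma)))}\in P$ for every $\gamma\in\mathrm{dom}(\phi)$; $P$ is local if the set of $\phi$ that are $r$-locally in $P$ equals $P$ for some $r$. A subshift has the join property (resp. is local) if $\mathrm{Fin}(\Omega)$ does (resp. is). $\Omega$ is reducible to $\Omega'$ if there is $\rho:\mathbb{N}\to\mathbb{N}$ with $\rho\circ\omega\in\Omega$ for all $\omega\in\Omega'$. *)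

theory Defs
  imports "HOL-Analysis.Analysis"
begin

text \<open>
  The group \<open>\<Gamma>\<close> is a type of class \<^class>\<open>group_add\<close>. This class is not commutative;
  \<open>\<gamma> + \<delta>\<close> stands for the product \<open>\<gamma>\<delta>\<close>, \<open>- \<gamma>\<close> for the inverse and \<open>0\<close> for the identity.
  Function spaces \<open>\<Gamma> \<Rightarrow> X\<close> carry the product topology, and \<open>nat\<close> is discrete.
\<close>

subsection \<open>Baire category\<close>

definition nowhere_dense :: "'x::topological_space set \<Rightarrow> bool" where
  "nowhere_dense A \<longleftrightarrow> interior (closure A) = {}"

definition meager :: "'x::topological_space set \<Rightarrow> bool" where
  "meager A \<longleftrightarrow> (\<exists>\<N>. countable \<N> \<and> (\<forall>N\<in>\<N>. nowhere_dense N) \<and> A = \<Union>\<N>)"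

definition comeager :: "'x::topological_space set \<Rightarrow> bool" where
  "comeager A \<longleftrightarrow> meager (- A)"

definition baire_property :: "'x::topological_space set \<Rightarrow> bool" where
  "baire_property A \<longleftrightarrow> (\<exists>U. open U \<and> meager ((A - U) \<union> (U - A)))"

definition baire_measurable :: "('x::topological_space \<Rightarrow> 'y::topological_space) \<Rightarrow> bool" where
  "baire_measurable f \<longleftrightarrow> (\<forall>V. open V \<longrightarrow> baire_property (f -` V))"

subsection \<open>The group metric\<close>

definition proper_right_invariant_metric :: "('g::group_add \<Rightarrow> 'g \<Rightarrow> real) \<Rightarrow> bool" where
  "proper_right_invariant_metric d \<longleftrightarrow>
     Metric_space UNIV d \<and>
     (\<forall>\<alpha> \<beta> \<gamma>. d (\<alpha> + \<gamma>) (\<beta> + \<gamma>) = d \<alpha> \<beta>) \<and>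
     (\<forall>\<gamma> r. finite (Metric_space.mcball UNIV d \<gamma> r))"

text \<open>Extended real values make the infimum over the empty set \<open>\<infinity>\<close>.\<close>

definition set_dist :: "('g \<Rightarrow> 'g \<Rightarrow> real) \<Rightarrow> 'g set \<Rightarrow> 'g set \<Rightarrow> ereal" where
  "set_dist d S T = (INF (\<gamma>, \<delta>)\<in>S \<times> T. ereal (d \<gamma> \<delta>))"

subsection \<open>Shifts, subshifts and colorings\<close>

text \<open>
  Applied to a partial map \<open>\<phi> :: \<Gamma> \<rightharpoonup> nat\<close>, the same formula gives the action on partial maps;
  see \<open>dom_shift\<close> below.
\<close>

definition shift :: "'g::group_add \<Rightarrow> ('g \<Rightarrow> 'x) \<Rightarrow> 'g \<Rightarrow> 'x" where
  "shift \<gamma> x = (\<lambda>\<delta>. x (\<delta> + \<gamma>))"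

definition subshift :: "('g::group_add \<Rightarrow> nat) set \<Rightarrow> bool" where
  "subshift \<Omega> \<longleftrightarrow> closed \<Omega> \<and> (\<forall>\<gamma>. \<forall>\<omega>\<in>\<Omega>. shift \<gamma> \<omega> \<in> \<Omega>)"

definition coding_map :: "('g \<Rightarrow> 'x \<Rightarrow> 'x) \<Rightarrow> ('x \<Rightarrow> nat) \<Rightarrow> 'x \<Rightarrow> 'g \<Rightarrow> nat" where
  "coding_map act f x = (\<lambda>\<gamma>. f (act \<gamma> x))"

definition baire_measurable_coloring ::
    "('g::group_add \<Rightarrow> 'x::polish_space \<Rightarrow> 'x) \<Rightarrow> ('g \<Rightarrow> nat) set \<Rightarrow> ('x \<Rightarrow> nat) \<Rightarrow> bool" where
  "baire_measurable_coloring act \<Omega> f \<longleftrightarrow>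
     baire_measurable f \<and> comeager (coding_map act f -` \<Omega>)"

definition reducible_to :: "('g \<Rightarrow> nat) set \<Rightarrow> ('g \<Rightarrow> nat) set \<Rightarrow> bool" where
  "reducible_to \<Omega> \<Omega>' \<longleftrightarrow> (\<exists>\<rho> :: nat \<Rightarrow> nat. \<forall>\<omega>\<in>\<Omega>'. \<rho> \<circ> \<omega> \<in> \<Omega>)"

subsection \<open>Finite partial maps\<close>

definition fin_maps :: "('g \<rightharpoonup> nat) set" where
  "fin_maps = {\<phi>. finite (dom \<phi>)}"

definition gamma_ideal :: "('g::group_add \<rightharpoonup> nat) set \<Rightarrow> bool" where
  "gamma_ideal P \<longleftrightarrow>
     P \<subseteq> fin_maps \<and>
     (\<forall>\<gamma>. \<forall>\<phi>\<in>P. shift \<gamma> \<phi> \<in> P) \<and>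
     (\<forall>\<phi>\<in>P. \<forall>S. \<phi> |` S \<in> P)"

definition Fin :: "('g \<Rightarrow> nat) set \<Rightarrow> ('g \<rightharpoonup> nat) set" where
  "Fin \<Omega> = {\<phi> \<in> fin_maps. \<exists>\<omega>\<in>\<Omega>. \<phi> \<subseteq>\<^sub>m (Some \<circ> \<omega>)}"

definition separated ::
    "('g \<Rightarrow> 'g \<Rightarrow> real) \<Rightarrow> (('g \<rightharpoonup> nat) \<Rightarrow> real) \<Rightarrow> ('g \<rightharpoonup> nat) \<Rightarrow> ('g \<rightharpoonup> nat) \<Rightarrow> bool" where
  "separated d R \<phi> \<psi> \<longleftrightarrow> set_dist d (dom \<phi>) (dom \<psi>) > ereal (R \<phi> + R \<psi>)"

text \<open>
  The values of \<open>R\<close> outside \<open>P\<close> are irrelevant. Separated maps have disjoint domains, so the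
  iterated \<open>++\<close> is the union of the maps, independently of the order of the list; for the
  empty list it is the empty map.
\<close>

definition join_property :: "('g::group_add \<Rightarrow> 'g \<Rightarrow> real) \<Rightarrow> ('g \<rightharpoonup> nat) set \<Rightarrow> bool" where
  "join_property d P \<longleftrightarrow>
     (\<exists>R :: ('g \<rightharpoonup> nat) \<Rightarrow> real.
        (\<forall>\<phi>\<in>P. 0 \<le> R \<phi>) \<and>
        (\<forall>\<gamma>. \<forall>\<phi>\<in>P. R (shift \<gamma> \<phi>) = R \<phi>) \<and>
        (\<forall>\<phi>s. set \<phi>s \<subseteq> P \<and>
              (\<forall>i<length \<phi>s. \<forall>j<length \<phi>s. i \<noteq> j \<longrightarrow> separated d R (\<phi>s ! i) (\<phi>s ! j)) \<longrightarrow>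
              foldr (++) \<phi>s Map.empty \<in> P))"

definition locally_in ::
    "('g \<Rightarrow> 'g \<Rightarrow> real) \<Rightarrow> (nat \<Rightarrow> real) \<Rightarrow> ('g \<rightharpoonup> nat) set \<Rightarrow> ('g \<rightharpoonup> nat) \<Rightarrow> bool" where
  "locally_in d r P \<phi> \<longleftrightarrow>
     (\<forall>\<gamma>\<in>dom \<phi>. \<phi> |` (dom \<phi> \<inter> Metric_space.mcball UNIV d \<gamma> (r (the (\<phi> \<gamma>)))) \<in> P)"

definition local_ideal :: "('g \<Rightarrow> 'g \<Rightarrow> real) \<Rightarrow> ('g \<rightharpoonup> nat) set \<Rightarrow> bool" where
  "local_ideal d P \<longleftrightarrow>
     (\<exists>r :: nat \<Rightarrow> real. (\<forall>n. 0 \<le> r n) \<and> {\<phi> \<in> fin_maps. locally_in d r P \<phi>} = P)"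

definition subshift_join_property ::
    "('g::group_add \<Rightarrow> 'g \<Rightarrow> real) \<Rightarrow> ('g \<Rightarrow> nat) set \<Rightarrow> bool" where
  "subshift_join_property d \<Omega> \<longleftrightarrow> join_property d (Fin \<Omega>)"

definition subshift_local :: "('g \<Rightarrow> 'g \<Rightarrow> real) \<Rightarrow> ('g \<Rightarrow> nat) set \<Rightarrow> bool" where
  "subshift_local d \<Omega> \<longleftrightarrow> local_ideal d (Fin \<Omega>)"

subsection \<open>Consistency of the encoding\<close>

lemma shift_zero: "shift 0 x = x"
  by (simp add: shift_def)

lemma shift_add: "shift (\<alpha> + \<beta>) x = shift \<alpha> (shift \<beta> x)"
  by (simp add: shift_def add.assoc)

lemma continuous_on_shift:
  "continuous_on UNIV (shift \<gamma> :: ('g::group_add \<Rightarrow> 'x::topological_space) \<Rightarrow> 'g \<Rightarrow> 'x)"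
  unfolding shift_def
  by (intro continuous_on_coordinatewise_then_product continuous_on_product_coordinates)

lemma dom_shift: "dom (shift \<gamma> \<phi>) = (\<lambda>\<delta>. \<delta> - \<gamma>) ` dom \<phi>"
proof (intro equalityI subsetI)
  fix \<delta> assume "\<delta> \<in> dom (shift \<gamma> \<phi>)"
  then have "\<delta> + \<gamma> \<in> dom \<phi>"
    by (auto simp: shift_def)
  then show "\<delta> \<in> (\<lambda>\<delta>. \<delta> - \<gamma>) ` dom \<phi>"
    by (rule rev_image_eqI) simp
qed (auto simp: shift_def)

lemma gamma_ideal_Fin:
  assumes "subshift \<Omega>"
  shows "gamma_ideal (Fin \<Omega>)"
  unfolding gamma_ideal_def
proof (intro conjI allI ballI)
  show "Fin \<Omega> \<subseteq> fin_maps"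
    by (auto simp: Fin_def)
next
  fix \<gamma> \<phi> assume "\<phi> \<in> Fin \<Omega>"
  then obtain \<omega> where \<omega>: "\<omega> \<in> \<Omega>" "\<phi> \<subseteq>\<^sub>m (Some \<circ> \<omega>)" and fin: "finite (dom \<phi>)"
    by (auto simp: Fin_def fin_maps_def)
  have "shift \<gamma> \<phi> \<subseteq>\<^sub>m (Some \<circ> shift \<gamma> \<omega>)"
    using \<omega>(2) by (auto simp: map_le_def shift_def dom_def)
  moreover have "shift \<gamma> \<omega> \<in> \<Omega>"
    using assms \<omega>(1) by (simp add: subshift_def)
  moreover have "finite (dom (shift \<gamma> \<phi>))"
    using fin by (simp add: dom_shift)
  ultimately show "shift \<gamma> \<phi> \<in> Fin \<Omega>"
    by (auto simp: Fin_def fin_maps_def)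
next
  fix \<phi> S assume "\<phi> \<in> Fin \<Omega>"
  then show "\<phi> |` S \<in> Fin \<Omega>"
    by (auto simp: Fin_def fin_maps_def map_le_def)
qed

end

theory Submission
  imports Defs
begin

text \<open>
  Call two finite patterns compatible if they are nested or separated. If \<open>\<Omega>'\<close> has the join
  property, the maximal members of a finite family of pairwise compatible patterns of \<open>\<Omega>'\<close> are
  separated, so the family has a common extension in \<open>\<Omega>'\<close>. Hence a choice of pairwise compatible
  patterns \<open>\<Psi> \<gamma>\<close> with \<open>\<gamma>\<close> in the domain of \<open>\<Psi> \<gamma>\<close> defines an element of \<open>\<Omega>'\<close>.

  (ii) implies (iii): label \<open>\<gamma>\<close> by a code of \<open>\<Psi> \<gamma>\<close>; compatibility is a local condition, and every
  finite compatible labelling extends.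
  (iii) implies (ii): a local subshift has the join property for \<open>R\<close> the largest radius occurring in
  the pattern, and the closure of its image under the reduction inherits it.
  (i) implies (ii): up to meager sets the colour classes are open; an open set of the shift
  space contains a set determined by finitely many coordinates, and sets determined by disjoint sets
  of coordinates meet.
  (ii) implies (i): enumerate a dense sequence of finitely supported points \<open>x n\<close> with trivial
  stabilizer. Choose in turn a pattern containing the identity that extends the earlier patterns
  visible at \<open>x n\<close>, and place it at every \<open>y\<close> in a small ball around \<open>x n\<close>. Only finitely many
  positions can be incompatible with it, so a small enough ball keeps all placed patterns compatible.
\<close>

section \<open>Baire category\<close>

lemma nowhere_dense_subset: "nowhere_dense B \<Longrightarrow> A \<subseteq> B \<Longrightarrow> nowhere_dense A"
  unfolding nowhere_dense_def by (metis closure_mono interior_mono subset_empty)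

lemma meager_subset:
  assumes "meager B" "A \<subseteq> B"
  shows "meager A"
proof -
  obtain \<N> where \<N>: "countable \<N>" "\<forall>N\<in>\<N>. nowhere_dense N" "B = \<Union>\<N>"
    using assms(1) unfolding meager_def by blast
  \<comment> \<open>\<open>meager\<close> demands equality with the union, so each piece of the
    cover of \<open>B\<close> is cut down to \<open>A\<close>.\<close>
  have "countable ((\<lambda>N. A \<inter> N) ` \<N>)" "A = \<Union>((\<lambda>N. A \<inter> N) ` \<N>)"
    using \<N> assms(2) by auto
  moreover have "\<forall>N\<in>(\<lambda>N. A \<inter> N) ` \<N>. nowhere_dense N"
    using \<N>(2) by (auto intro: nowhere_dense_subset)
  ultimately show ?thesis
    unfolding meager_def by blast
qed

lemma meager_UN:
  assumes "countable I" "\<And>i. i \<in> I \<Longrightarrow> meager (A i)"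
  shows "meager (\<Union>i\<in>I. A i)"
proof -
  have "\<forall>i\<in>I. \<exists>\<N>. countable \<N> \<and> (\<forall>N\<in>\<N>. nowhere_dense N) \<and> A i = \<Union>\<N>"
    using assms(2) unfolding meager_def by blast
  then obtain \<N> where \<N>: "\<And>i. i \<in> I \<Longrightarrow> countable (\<N> i)"
      "\<And>i N. i \<in> I \<Longrightarrow> N \<in> \<N> i \<Longrightarrow> nowhere_dense N" "\<And>i. i \<in> I \<Longrightarrow> A i = \<Union>(\<N> i)"
    by metis
  show ?thesis
    unfolding meager_def
    by (rule exI[of _ "\<Union>i\<in>I. \<N> i"]) (use \<N> assms(1) in auto)
qed

lemma meager_closed_dense_complement:
  assumes "open W" "closure W = UNIV"
  shows "meager (- W)"
proof -
  have "nowhere_dense (- W)"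
    unfolding nowhere_dense_def using assms
    by (simp add: closed_Compl closure_closed interior_complement)
  then show ?thesis
    unfolding meager_def by (intro exI[of _ "{- W}"]) auto
qed

text \<open>This is the Baire category theorem for a complete metric: countably many closed sets
  with empty interior have a union with empty interior, while the closures of nowhere dense pieces
  of \<open>U\<close> would cover \<open>U\<close>.\<close>

lemma nonmeager_open:
  fixes U :: "'x::polish_space set"
  assumes "open U" "U \<noteq> {}"
  shows "\<not> meager U"
proof
  assume "meager U"
  then obtain \<N> where \<N>: "countable \<N>" "\<forall>N\<in>\<N>. nowhere_dense N" "U = \<Union>\<N>"
    unfolding meager_def by blast
  have "interior (\<Union>(closure ` \<N>)) = {}"
  proof -
    have "Met_TC.mtopology interior_of (\<Union>(closure ` \<N>)) = ({} :: 'x set)"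
    proof (rule Met_TC.metric_Baire_category_alt)
      show "Met_TC.mcomplete TYPE('x)"
        by (simp add: complete_UNIV mcomplete_iff_complete)
      show "countable (closure ` \<N>)"
        using \<N>(1) by blast
      fix T assume "T \<in> closure ` \<N>"
      then show "closedin Met_TC.mtopology T \<and> Met_TC.mtopology interior_of T = {}"
        using \<N>(2) by (auto simp: nowhere_dense_def)
    qed
    then show ?thesis by simp
  qed
  moreover have "U \<subseteq> interior (\<Union>(closure ` \<N>))"
    using \<N>(3) assms(1) closure_subset by (intro interior_maximal) fastforce+
  ultimately show False
    using assms(2) by blast
qed

lemma open_meets_comeager:
  fixes U :: "'x::polish_space set"
  assumes "open U" "U \<noteq> {}" "comeager G"
  obtains x where "x \<in> U" "x \<in> G"
  using assms nonmeager_open meager_subset unfolding comeager_def by blast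

section \<open>Category notions under the shift homeomorphisms\<close>

lemma open_vimage_shift:
  fixes U :: "('g::group_add \<Rightarrow> 'x::topological_space) set"
  shows "open U \<Longrightarrow> open (shift \<gamma> -` U)"
  using continuous_on_shift open_vimage by blast

lemma shift_minus_cancel [simp]: "shift (- \<gamma>) (shift \<gamma> x) = x" "shift \<gamma> (shift (- \<gamma>) x) = x"
  by (simp_all flip: shift_add add: shift_zero)

text \<open>Continuity of \<open>shift \<gamma>\<close> gives one inclusion, and continuity of its
  inverse \<open>shift (- \<gamma>)\<close> the other.\<close>

lemma closure_vimage_shift:
  fixes A :: "('g::group_add \<Rightarrow> 'x::topological_space) set"
  shows "closure (shift \<gamma> -` A) = shift \<gamma> -` closure A"
proof -
  have sub: "closure (shift \<gamma> -` A) \<subseteq> shift \<gamma> -` closure A" for A :: "('g \<Rightarrow> 'x) set" and \<gamma>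
  proof (rule closure_minimal)
    show "closed (shift \<gamma> -` closure A)"
      using continuous_on_shift closed_vimage by blast
  qed (use closure_subset in auto)
  have "shift \<gamma> -` closure A \<subseteq> closure (shift \<gamma> -` A)"
  proof
    fix x assume "x \<in> shift \<gamma> -` closure A"
    moreover have "shift (- \<gamma>) -` shift \<gamma> -` A = A"
      by auto
    ultimately have "shift \<gamma> x \<in> shift (- \<gamma>) -` closure (shift \<gamma> -` A)"
      using sub[of "- \<gamma>" "shift \<gamma> -` A"] by auto
    then show "x \<in> closure (shift \<gamma> -` A)"
      by simp
  qed
  with sub show ?thesis by blast
qed

lemma nowhere_dense_vimage_shift:
  fixes A :: "('g::group_add \<Rightarrow> 'x::topological_space) set"
  assumes "nowhere_dense A"
  shows "nowhere_dense (shift \<gamma> -` A)"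
proof -
  have "shift (- \<gamma>) -` interior (shift \<gamma> -` closure A) \<subseteq> interior (closure A)"
    by (rule interior_maximal) (use interior_subset in \<open>auto intro!: open_vimage_shift\<close>, fastforce)
  with assms have "shift (- \<gamma>) -` interior (shift \<gamma> -` closure A) = {}"
    by (simp add: nowhere_dense_def)
  then have "interior (shift \<gamma> -` closure A) = {}"
    by (metis empty_iff shift_minus_cancel(1) subsetI subset_empty vimageI)
  then show ?thesis
    by (simp add: nowhere_dense_def closure_vimage_shift)
qed

lemma meager_vimage_shift:
  fixes A :: "('g::group_add \<Rightarrow> 'x::topological_space) set"
  assumes "meager A"
  shows "meager (shift \<gamma> -` A)"
proof -
  obtain \<N> where \<N>: "countable \<N>" "\<forall>N\<in>\<N>. nowhere_dense N" "A = \<Union>\<N>"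
    using assms unfolding meager_def by blast
  show ?thesis
    unfolding meager_def
    by (rule exI[of _ "(\<lambda>N. shift \<gamma> -` N) ` \<N>"]) (use \<N> in \<open>auto intro: nowhere_dense_vimage_shift\<close>)
qed

section \<open>Finite coordinates\<close>

lemma open_fun_finite_support:
  fixes U :: "('i \<Rightarrow> 'x::topological_space) set"
  assumes "open U" "x \<in> U"
  obtains S where "finite S" "\<forall>y. (\<forall>i\<in>S. y i = x i) \<longrightarrow> y \<in> U"
proof -
  have "openin (product_topology (\<lambda>i. euclidean) UNIV) U"
    using assms(1) unfolding open_fun_def .
  from product_topology_open_contains_basis[OF this assms(2)]
  obtain X where X: "x \<in> (\<Pi>\<^sub>E i\<in>UNIV. X i)" "finite {i. X i \<noteq> UNIV}" "(\<Pi>\<^sub>E i\<in>UNIV. X i) \<subseteq> U"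
    by auto
  show ?thesis
  proof (rule that[OF X(2)], intro allI impI)
    fix y assume y: "\<forall>i\<in>{i. X i \<noteq> UNIV}. y i = x i"
    have "y i \<in> X i" for i
      using y X(1) by (cases "X i = UNIV") (auto simp: PiE_iff)
    then show "y \<in> U"
      using X(3) by auto
  qed
qed

lemma open_cylinder:
  fixes \<omega> :: "'i \<Rightarrow> nat"
  assumes "finite S"
  shows "open {\<omega>'. \<forall>i\<in>S. \<omega>' i = \<omega> i}"
  using product_topology_basis'[OF assms, of "\<lambda>i. {\<omega> i}" id] by (simp add: open_discrete)

text \<open>As \<open>nat\<close> is discrete, the sets fixing the values on a finite
  \<open>S\<close> form a neighbourhood base at \<open>\<omega>\<close>.\<close>

lemma closure_fun_nat:
  fixes A :: "('i \<Rightarrow> nat) set"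
  shows "\<omega> \<in> closure A \<longleftrightarrow> (\<forall>S. finite S \<longrightarrow> (\<exists>\<omega>'\<in>A. \<forall>i\<in>S. \<omega>' i = \<omega> i))"
proof (intro iffI allI impI)
  fix S :: "'i set" assume "\<omega> \<in> closure A" "finite S"
  then have "{\<omega>'. \<forall>i\<in>S. \<omega>' i = \<omega> i} \<inter> closure A \<noteq> {}"
    by blast
  then have "{\<omega>'. \<forall>i\<in>S. \<omega>' i = \<omega> i} \<inter> A \<noteq> {}"
    using open_Int_closure_eq_empty[OF open_cylinder[OF \<open>finite S\<close>]] by blast
  then show "\<exists>\<omega>'\<in>A. \<forall>i\<in>S. \<omega>' i = \<omega> i"
    by blast
next
  assume *: "\<forall>S. finite S \<longrightarrow> (\<exists>\<omega>'\<in>A. \<forall>i\<in>S. \<omega>' i = \<omega> i)"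
  show "\<omega> \<in> closure A"
  proof (rule ccontr)
    assume "\<omega> \<notin> closure A"
    then have "open (- closure A)" "\<omega> \<in> - closure A"
      by auto
    then obtain S where S: "finite S" "\<forall>y. (\<forall>i\<in>S. y i = \<omega> i) \<longrightarrow> y \<in> - closure A"
      by (rule open_fun_finite_support)
    obtain \<omega>' where \<omega>': "\<omega>' \<in> A" "\<forall>i\<in>S. \<omega>' i = \<omega> i"
      using * S(1) by blast
    have "\<omega>' \<in> - closure A"
      using S(2) \<omega>'(2) by blast
    then show False
      using \<omega>'(1) closure_subset[of A] by blast
  qed
qed

section \<open>Finite patterns of closures and of subshifts\<close>

lemma Fin_iff: "\<phi> \<in> Fin \<Omega> \<longleftrightarrow> finite (dom \<phi>) \<and> (\<exists>\<omega>\<in>\<Omega>. \<forall>\<gamma>\<in>dom \<phi>. \<phi> \<gamma> = Some (\<omega> \<gamma>))"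
  by (auto simp: Fin_def fin_maps_def map_le_def)

text \<open>A finite pattern tests finitely many coordinates, so limits show no new ones. Hence a
  subshift can be built as the closure of an invariant set and its patterns read off from the set
  itself.\<close>

lemma Fin_closure: "Fin (closure \<Omega>) = Fin \<Omega>"
proof
  show "Fin (closure \<Omega>) \<subseteq> Fin \<Omega>"
  proof
    fix \<phi> assume "\<phi> \<in> Fin (closure \<Omega>)"
    then obtain \<omega> where \<omega>: "finite (dom \<phi>)" "\<omega> \<in> closure \<Omega>" "\<forall>\<gamma>\<in>dom \<phi>. \<phi> \<gamma> = Some (\<omega> \<gamma>)"
      by (auto simp: Fin_iff)
    then obtain \<omega>' where "\<omega>' \<in> \<Omega>" "\<forall>\<gamma>\<in>dom \<phi>. \<omega>' \<gamma> = \<omega> \<gamma>"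
      unfolding closure_fun_nat by blast
    then have "\<forall>\<gamma>\<in>dom \<phi>. \<phi> \<gamma> = Some (\<omega>' \<gamma>)"
      using \<omega>(3) by simp
    then show "\<phi> \<in> Fin \<Omega>"
      using \<omega>(1) \<open>\<omega>' \<in> \<Omega>\<close> unfolding Fin_iff by blast
  qed
  show "Fin \<Omega> \<subseteq> Fin (closure \<Omega>)"
    using closure_subset[of \<Omega>] unfolding Fin_def by blast
qed

lemma subshift_closure:
  assumes "\<And>\<gamma> \<omega>. \<omega> \<in> A \<Longrightarrow> shift \<gamma> \<omega> \<in> A"
  shows "subshift (closure A)"
  unfolding subshift_def
proof (intro conjI allI ballI)
  fix \<gamma> \<omega> assume "\<omega> \<in> closure A"
  moreover have "closure A \<subseteq> closure (shift \<gamma> -` A)"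
    by (rule closure_mono) (use assms in auto)
  ultimately show "shift \<gamma> \<omega> \<in> closure A"
    by (auto simp: closure_vimage_shift)
qed simp

lemma Fin_shift: "subshift \<Omega> \<Longrightarrow> \<phi> \<in> Fin \<Omega> \<Longrightarrow> shift \<gamma> \<phi> \<in> Fin \<Omega>"
  using gamma_ideal_Fin unfolding gamma_ideal_def by blast

lemma Fin_restrict: "\<phi> \<in> Fin \<Omega> \<Longrightarrow> \<psi> \<subseteq>\<^sub>m \<phi> \<Longrightarrow> \<psi> \<in> Fin \<Omega>"
  by (auto simp: Fin_def fin_maps_def intro: map_le_trans finite_subset[OF map_le_implies_dom_le])

section \<open>Separation and joins\<close>

text \<open>On finite nonempty domains the infimum is a minimum, so the strict inequality passes to
  every pair. If a domain is empty, the infimum is \<infinity> and both sides hold.\<close>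

lemma separated_iff:
  assumes "finite (dom \<phi>)" "finite (dom \<psi>)"
  shows "separated d R \<phi> \<psi> \<longleftrightarrow> (\<forall>a\<in>dom \<phi>. \<forall>b\<in>dom \<psi>. R \<phi> + R \<psi> < d a b)"
proof -
  have "separated d R \<phi> \<psi> \<longleftrightarrow> (\<forall>p\<in>dom \<phi> \<times> dom \<psi>. ereal (R \<phi> + R \<psi>) < (case p of (a, b) \<Rightarrow> ereal (d a b)))"
  proof (cases "dom \<phi> \<times> dom \<psi> = {}")
    case True
    then show ?thesis
      unfolding separated_def set_dist_def True by (simp add: top_ereal_def)
  next
    case False
    then show ?thesis
      unfolding separated_def set_dist_def using assms
      by (subst cInf_eq_Min) (auto simp: Min_gr_iff)
  qed
  then show ?thesis by auto
qed

lemma dom_foldr_map_add: "dom (foldr (++) \<phi>s Map.empty) = (\<Union>\<phi>\<in>set \<phi>s. dom \<phi>)"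
  by (induction \<phi>s) auto

text \<open>Where the maps agree on overlaps, the overriding done by \<open>++\<close> changes
  nothing, whatever the order of the list.\<close>

lemma foldr_map_add_eq:
  assumes "\<And>\<phi> \<psi> a. \<phi> \<in> set \<phi>s \<Longrightarrow> \<psi> \<in> set \<phi>s \<Longrightarrow> a \<in> dom \<phi> \<Longrightarrow> a \<in> dom \<psi> \<Longrightarrow> \<phi> a = \<psi> a"
    and "\<phi> \<in> set \<phi>s" "a \<in> dom \<phi>"
  shows "foldr (++) \<phi>s Map.empty a = \<phi> a"
  using assms
proof (induction \<phi>s arbitrary: \<phi>)
  case (Cons \<psi> \<phi>s)
  show ?case
  proof (cases "\<exists>\<xi>\<in>set \<phi>s. a \<in> dom \<xi>")
    case True
    then obtain \<xi> where \<xi>: "\<xi> \<in> set \<phi>s" "a \<in> dom \<xi>" by blast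
    then have "foldr (++) \<phi>s Map.empty a = \<xi> a"
      using Cons.prems(1) by (intro Cons.IH) auto
    moreover have "\<xi> a = \<phi> a"
      using Cons.prems \<xi> by auto
    moreover obtain y where "\<xi> a = Some y"
      using \<xi>(2) by blast
    ultimately have "foldr (++) \<phi>s Map.empty a = Some y" "\<phi> a = Some y"
      by auto
    then show ?thesis
      by simp
  next
    case False
    then have "a \<notin> dom (foldr (++) \<phi>s Map.empty)"
      by (auto simp: dom_foldr_map_add)
    moreover have "\<phi> = \<psi>"
      using False Cons.prems by auto
    ultimately show ?thesis
      by (simp add: map_add_dom_app_simps(3))
  qed
qed simp

lemma map_le_iff_eq: "\<phi> \<subseteq>\<^sub>m \<psi> \<longleftrightarrow> (\<forall>a\<in>dom \<phi>. \<phi> a = \<psi> a)"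
  by (simp add: map_le_def)

lemma map_le_shift: "\<phi> \<subseteq>\<^sub>m \<psi> \<Longrightarrow> shift \<gamma> \<phi> \<subseteq>\<^sub>m shift \<gamma> \<psi>"
  by (auto simp: map_le_def shift_def dom_def)

lemma proper_metricD:
  assumes "proper_right_invariant_metric d"
  shows "Metric_space UNIV d" "d (\<alpha> + \<gamma>) (\<beta> + \<gamma>) = d \<alpha> \<beta>" "finite {\<delta>. d \<gamma> \<delta> \<le> r}"
proof -
  show M: "Metric_space UNIV d"
    using assms by (simp add: proper_right_invariant_metric_def)
  show "d (\<alpha> + \<gamma>) (\<beta> + \<gamma>) = d \<alpha> \<beta>"
    using assms by (simp add: proper_right_invariant_metric_def)
  show "finite {\<delta>. d \<gamma> \<delta> \<le> r}"
    using assms by (simp add: proper_right_invariant_metric_def Metric_space.mcball_def[OF M])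
qed

section \<open>Compatible patterns in a subshift with a fixed separation radius
  \<open>R\<close>\<close>

locale joinable =
  fixes d :: "'g::{group_add,countable} \<Rightarrow> 'g \<Rightarrow> real" and \<Omega> :: "('g \<Rightarrow> nat) set" and R :: "('g \<rightharpoonup> nat) \<Rightarrow> real"
  assumes proper: "proper_right_invariant_metric d"
    and subshift: "subshift \<Omega>"
    and R_nonneg: "\<phi> \<in> Fin \<Omega> \<Longrightarrow> 0 \<le> R \<phi>"
    and R_shift: "\<phi> \<in> Fin \<Omega> \<Longrightarrow> R (shift \<gamma> \<phi>) = R \<phi>"
    and join: "set \<phi>s \<subseteq> Fin \<Omega> \<Longrightarrow>
        \<forall>i<length \<phi>s. \<forall>j<length \<phi>s. i \<noteq> j \<longrightarrow> separated d R (\<phi>s ! i) (\<phi>s ! j) \<Longrightarrow>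
        foldr (++) \<phi>s Map.empty \<in> Fin \<Omega>"
begin

sublocale Metric_space UNIV d
  using proper by (rule proper_metricD)

definition compatible :: "('g \<rightharpoonup> nat) \<Rightarrow> ('g \<rightharpoonup> nat) \<Rightarrow> bool" where
  "compatible \<phi> \<psi> \<longleftrightarrow> \<phi> \<subseteq>\<^sub>m \<psi> \<or> \<psi> \<subseteq>\<^sub>m \<phi> \<or> separated d R \<phi> \<psi>"

lemma finite_dom: "\<phi> \<in> Fin \<Omega> \<Longrightarrow> finite (dom \<phi>)"
  by (simp add: Fin_iff)

lemma separated_Fin_iff:
  "\<phi> \<in> Fin \<Omega> \<Longrightarrow> \<psi> \<in> Fin \<Omega> \<Longrightarrow> separated d R \<phi> \<psi> \<longleftrightarrow> (\<forall>a\<in>dom \<phi>. \<forall>b\<in>dom \<psi>. R \<phi> + R \<psi> < d a b)"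
  by (intro separated_iff finite_dom)

lemma separated_sym:
  assumes "\<phi> \<in> Fin \<Omega>" "\<psi> \<in> Fin \<Omega>" "separated d R \<phi> \<psi>"
  shows "separated d R \<psi> \<phi>"
proof -
  have "R \<psi> + R \<phi> < d b a" if "a \<in> dom \<phi>" "b \<in> dom \<psi>" for a b
  proof -
    have "R \<phi> + R \<psi> < d a b"
      using that assms(3) separated_Fin_iff[OF assms(1,2)] by blast
    then show ?thesis
      unfolding commute[of b a] by linarith
  qed
  then show ?thesis
    using separated_Fin_iff[OF assms(2,1)] by blast
qed

text \<open>A common point has distance \<open>0\<close> from itself, which cannot exceed the
  nonnegative \<open>R \<phi> + R \<psi>\<close>.\<close>

lemma separated_dom_disjoint:
  assumes "\<phi> \<in> Fin \<Omega>" "\<psi> \<in> Fin \<Omega>" "separated d R \<phi> \<psi>"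
  shows "dom \<phi> \<inter> dom \<psi> = {}"
proof (rule ccontr)
  assume "dom \<phi> \<inter> dom \<psi> \<noteq> {}"
  then obtain a where "a \<in> dom \<phi>" "a \<in> dom \<psi>" by blast
  then have "R \<phi> + R \<psi> < d a a"
    using assms separated_Fin_iff by blast
  then show False
    using R_nonneg[OF assms(1)] R_nonneg[OF assms(2)] by simp
qed

lemma compatible_sym: "\<phi> \<in> Fin \<Omega> \<Longrightarrow> \<psi> \<in> Fin \<Omega> \<Longrightarrow> compatible \<phi> \<psi> \<Longrightarrow> compatible \<psi> \<phi>"
  using separated_sym[of \<phi> \<psi>] unfolding compatible_def by blast

lemma compatible_agree:
  assumes "\<phi> \<in> Fin \<Omega>" "\<psi> \<in> Fin \<Omega>" "compatible \<phi> \<psi>" "a \<in> dom \<phi>" "a \<in> dom \<psi>"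
  shows "\<phi> a = \<psi> a"
proof -
  have "\<not> separated d R \<phi> \<psi>"
    using assms separated_dom_disjoint by blast
  then show ?thesis
    using assms(3-5) unfolding compatible_def map_le_iff_eq by force
qed

lemma Fin_shift': "\<phi> \<in> Fin \<Omega> \<Longrightarrow> shift \<gamma> \<phi> \<in> Fin \<Omega>"
  using Fin_shift subshift by blast

lemma dist_diff: "d (a - \<gamma>) (b - \<gamma>) = d a b"
  using proper_metricD(2)[OF proper, of a "- \<gamma>" b] by simp

text \<open>A shift translates domains on the right, where \<open>d\<close> is invariant, and leaves
  \<open>R\<close> unchanged.\<close>

lemma separated_shift:
  assumes "\<phi> \<in> Fin \<Omega>" "\<psi> \<in> Fin \<Omega>"
  shows "separated d R (shift \<gamma> \<phi>) (shift \<gamma> \<psi>) \<longleftrightarrow> separated d R \<phi> \<psi>"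
  using assms by (simp add: separated_Fin_iff Fin_shift' R_shift dom_shift dist_diff)

lemma compatible_shift:
  assumes "\<phi> \<in> Fin \<Omega>" "\<psi> \<in> Fin \<Omega>" "compatible \<phi> \<psi>"
  shows "compatible (shift \<gamma> \<phi>) (shift \<gamma> \<psi>)"
  using assms by (auto simp: compatible_def separated_shift intro: map_le_shift)

lemma join_set:
  assumes "finite Q" "Q \<subseteq> Fin \<Omega>" "\<And>\<phi> \<psi>. \<phi> \<in> Q \<Longrightarrow> \<psi> \<in> Q \<Longrightarrow> \<phi> \<noteq> \<psi> \<Longrightarrow> separated d R \<phi> \<psi>"
  shows "\<exists>\<Phi>\<in>Fin \<Omega>. \<forall>\<phi>\<in>Q. \<phi> \<subseteq>\<^sub>m \<Phi>"
proof -
  \<comment> \<open>A distinct list turns different indices into different patterns, as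
    \<open>join\<close> speaks of indices.\<close>
  obtain \<phi>s where \<phi>s: "set \<phi>s = Q" "distinct \<phi>s"
    using finite_distinct_list assms(1) by blast
  have "foldr (++) \<phi>s Map.empty \<in> Fin \<Omega>"
    using assms \<phi>s by (intro join) (auto simp: nth_eq_iff_index_eq)
  moreover have "\<phi> \<subseteq>\<^sub>m foldr (++) \<phi>s Map.empty" if "\<phi> \<in> Q" for \<phi>
    unfolding map_le_iff_eq
  proof (intro ballI sym[OF foldr_map_add_eq])
    fix \<phi> \<psi> a assume *: "\<phi> \<in> set \<phi>s" "\<psi> \<in> set \<phi>s" "a \<in> dom \<phi>" "a \<in> dom \<psi>"
    then have "\<phi> \<in> Fin \<Omega>" "\<psi> \<in> Fin \<Omega>"
      using assms(2) \<phi>s by auto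
    then show "\<phi> a = \<psi> a"
      using * separated_dom_disjoint assms(3) \<phi>s(1) by blast
  qed (use that \<phi>s in auto)
  ultimately show ?thesis by blast
qed

lemma join_compatible:
  assumes "finite Q" "Q \<subseteq> Fin \<Omega>" "\<And>\<phi> \<psi>. \<phi> \<in> Q \<Longrightarrow> \<psi> \<in> Q \<Longrightarrow> compatible \<phi> \<psi>"
  shows "\<exists>\<Phi>\<in>Fin \<Omega>. \<forall>\<phi>\<in>Q. \<phi> \<subseteq>\<^sub>m \<Phi>"
proof -
  \<comment> \<open>The family is thinned out, inserting one pattern at a time, to pairwise
    separated patterns that still dominate all of \<open>Q\<close>.\<close>
  have "\<exists>Q'\<subseteq>Q. (\<forall>\<phi>\<in>Q'. \<forall>\<psi>\<in>Q'. \<phi> \<noteq> \<psi> \<longrightarrow> separated d R \<phi> \<psi>) \<and> (\<forall>\<phi>\<in>Q. \<exists>\<psi>\<in>Q'. \<phi> \<subseteq>\<^sub>m \<psi>)"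
    using assms
  proof (induction Q rule: finite_induct)
    case (insert \<xi> Q)
    then obtain Q' where Q': "Q' \<subseteq> Q" "\<forall>\<phi>\<in>Q'. \<forall>\<psi>\<in>Q'. \<phi> \<noteq> \<psi> \<longrightarrow> separated d R \<phi> \<psi>"
        "\<forall>\<phi>\<in>Q. \<exists>\<psi>\<in>Q'. \<phi> \<subseteq>\<^sub>m \<psi>"
      by (metis (no_types, lifting) insertI2 insert_subset)
    show ?case
    proof (cases "\<exists>\<psi>\<in>Q'. \<xi> \<subseteq>\<^sub>m \<psi>")
      case True
      then show ?thesis
        using Q' by (intro exI[of _ Q']) auto
    next
      case False
      have sep: "separated d R \<phi> \<xi> \<and> separated d R \<xi> \<phi>" if "\<phi> \<in> Q'" "\<not> \<phi> \<subseteq>\<^sub>m \<xi>" for \<phi>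
      proof -
        have "\<phi> \<in> Fin \<Omega>" "\<xi> \<in> Fin \<Omega>" "compatible \<phi> \<xi>"
          using that Q'(1) insert.prems by auto
        then show ?thesis
          using that False separated_sym[of \<phi> \<xi>] unfolding compatible_def by blast
      qed
      \<comment> \<open>The new pattern \<open>\<xi>\<close> absorbs the members of
        \<open>Q'\<close> below it. From the others it is separated, since neither contains the
        other.\<close>
      show ?thesis
      proof (intro exI[of _ "insert \<xi> {\<phi> \<in> Q'. \<not> \<phi> \<subseteq>\<^sub>m \<xi>}"] conjI)
        show "\<forall>\<phi>\<in>insert \<xi> Q. \<exists>\<psi>\<in>insert \<xi> {\<phi> \<in> Q'. \<not> \<phi> \<subseteq>\<^sub>m \<xi>}. \<phi> \<subseteq>\<^sub>m \<psi>"
          using Q'(3) by (auto intro: map_le_trans)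
      qed (use Q' sep in auto)
    qed
  qed simp
  then obtain Q' where Q': "Q' \<subseteq> Q" "\<forall>\<phi>\<in>Q'. \<forall>\<psi>\<in>Q'. \<phi> \<noteq> \<psi> \<longrightarrow> separated d R \<phi> \<psi>"
      "\<forall>\<phi>\<in>Q. \<exists>\<psi>\<in>Q'. \<phi> \<subseteq>\<^sub>m \<psi>" by blast
  then have "\<exists>\<Phi>\<in>Fin \<Omega>. \<forall>\<phi>\<in>Q'. \<phi> \<subseteq>\<^sub>m \<Phi>"
    using assms by (intro join_set) (auto intro: finite_subset)
  then show ?thesis
    using Q'(3) map_le_trans by blast
qed

text \<open>The join is part of some \<open>\<omega>\<close> in the subshift, whose value at
  \<open>\<gamma>\<close> can be added to it.\<close>

lemma join_compatible_extend:
  assumes "finite Q" "Q \<subseteq> Fin \<Omega>" "\<And>\<phi> \<psi>. \<phi> \<in> Q \<Longrightarrow> \<psi> \<in> Q \<Longrightarrow> compatible \<phi> \<psi>"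
  shows "\<exists>\<Phi>\<in>Fin \<Omega>. \<gamma> \<in> dom \<Phi> \<and> (\<forall>\<phi>\<in>Q. \<phi> \<subseteq>\<^sub>m \<Phi>)"
proof -
  obtain \<Phi> where \<Phi>: "\<Phi> \<in> Fin \<Omega>" "\<forall>\<phi>\<in>Q. \<phi> \<subseteq>\<^sub>m \<Phi>"
    using join_compatible[OF assms] by blast
  then obtain \<omega> where \<omega>: "\<omega> \<in> \<Omega>" "\<forall>\<gamma>\<in>dom \<Phi>. \<Phi> \<gamma> = Some (\<omega> \<gamma>)"
    by (auto simp: Fin_iff)
  let ?\<Phi> = "\<Phi>(\<gamma> \<mapsto> \<omega> \<gamma>)"
  have le: "\<Phi> \<subseteq>\<^sub>m ?\<Phi>"
    using \<omega>(2) by (auto simp: map_le_def)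
  have "?\<Phi> \<in> Fin \<Omega>"
    using \<omega> \<Phi>(1) by (auto simp: Fin_iff)
  moreover have "\<forall>\<phi>\<in>Q. \<phi> \<subseteq>\<^sub>m ?\<Phi>"
    using \<Phi>(2) le map_le_trans by blast
  ultimately show ?thesis
    by (intro bexI[of _ ?\<Phi>]) auto
qed

text \<open>On a finite \<open>S\<close> the function \<open>\<omega>\<close> is part of the join of
  the patterns \<open>\<Psi> \<gamma>\<close> with \<open>\<gamma>\<close> in \<open>S\<close>, so
  it is a limit of points of the closed set \<open>\<Omega>\<close>.\<close>

lemma compatible_family_in_subshift:
  assumes "\<And>\<gamma>. \<Psi> \<gamma> \<in> Fin \<Omega>" "\<And>\<gamma>. \<Psi> \<gamma> \<gamma> = Some (\<omega> \<gamma>)" "\<And>\<gamma> \<delta>. compatible (\<Psi> \<gamma>) (\<Psi> \<delta>)"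
  shows "\<omega> \<in> \<Omega>"
proof -
  have "\<omega> \<in> closure \<Omega>"
    unfolding closure_fun_nat
  proof (intro allI impI)
    fix S :: "'g set" assume "finite S"
    then obtain \<Phi> where \<Phi>: "\<Phi> \<in> Fin \<Omega>" "\<forall>\<phi>\<in>\<Psi> ` S. \<phi> \<subseteq>\<^sub>m \<Phi>"
      using join_compatible[of "\<Psi> ` S"] assms(1,3) by blast
    then obtain \<omega>' where \<omega>': "\<omega>' \<in> \<Omega>" "\<forall>\<gamma>\<in>dom \<Phi>. \<Phi> \<gamma> = Some (\<omega>' \<gamma>)"
      by (auto simp: Fin_iff)
    have "\<omega>' \<gamma> = \<omega> \<gamma>" if "\<gamma> \<in> S" for \<gamma>
    proof -
      have "\<Phi> \<gamma> = Some (\<omega> \<gamma>)"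
        using \<Phi>(2) that assms(2)[of \<gamma>] unfolding map_le_def by (metis domI imageI)
      then show ?thesis
        using \<omega>'(2) by (metis domI option.inject)
    qed
    then show "\<exists>\<omega>'\<in>\<Omega>. \<forall>i\<in>S. \<omega>' i = \<omega> i"
      using \<omega>'(1) by blast
  qed
  then show ?thesis
    using subshift by (simp add: subshift_def)
qed

end

lemma subshift_join_propertyE:
  fixes d :: "'g::{group_add,countable} \<Rightarrow> 'g \<Rightarrow> real"
  assumes "subshift_join_property d \<Omega>" "subshift \<Omega>" "proper_right_invariant_metric d"
  obtains R where "joinable d \<Omega> R"
proof -
  from assms(1) obtain R where
    "\<forall>\<phi>\<in>Fin \<Omega>. 0 \<le> R \<phi>" "\<forall>\<gamma>. \<forall>\<phi>\<in>Fin \<Omega>. R (shift \<gamma> \<phi>) = R \<phi>"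
    "\<forall>\<phi>s. set \<phi>s \<subseteq> Fin \<Omega> \<and>
      (\<forall>i<length \<phi>s. \<forall>j<length \<phi>s. i \<noteq> j \<longrightarrow> separated d R (\<phi>s ! i) (\<phi>s ! j)) \<longrightarrow>
      foldr (++) \<phi>s Map.empty \<in> Fin \<Omega>"
    unfolding subshift_join_property_def join_property_def by blast
  then have "joinable d \<Omega> R"
    using assms(2,3) by unfold_locales auto
  then show thesis ..
qed

section \<open>From colorings to the join property\<close>

lemma foldr_map_add_SomeD:
  "foldr (++) \<phi>s Map.empty a = Some n \<Longrightarrow> \<exists>\<phi>\<in>set \<phi>s. \<phi> a = Some n"
  by (induction \<phi>s) auto

lemma coloring_imp_join:
  fixes d :: "'g::{group_add,countable} \<Rightarrow> 'g \<Rightarrow> real" and f :: "('g \<Rightarrow> 'z::polish_space) \<Rightarrow> nat"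
  assumes d: "proper_right_invariant_metric d" and sub: "subshift \<Omega>"
    and f: "baire_measurable_coloring shift \<Omega> f"
  shows "\<exists>\<Omega>'. subshift \<Omega>' \<and> subshift_join_property d \<Omega>' \<and> \<Omega>' \<subseteq> \<Omega>"
proof -
  interpret Metric_space UNIV d
    using d by (rule proper_metricD)
  have dist_diff: "d (\<alpha> - \<gamma>) (\<beta> - \<gamma>) = d \<alpha> \<beta>" for \<alpha> \<beta> \<gamma>
    using proper_metricD(2)[OF d, of \<alpha> "- \<gamma>" \<beta>] by simp
  let ?c = "coding_map shift f"
  \<comment> \<open>Each colour class has the Baire property, so it is an open set
    \<open>U n\<close> up to a meager error.\<close>
  have "\<exists>U. open U \<and> meager ((f -` {n} - U) \<union> (U - f -` {n}))" for n
    using f by (simp add: baire_measurable_coloring_def baire_measurable_def baire_property_def open_discrete)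
  then obtain U where U: "\<And>n. open (U n)" "\<And>n. meager ((f -` {n} - U n) \<union> (U n - f -` {n}))"
    by metis
  \<comment> \<open>\<open>G\<close> collects the points whose code lies in \<open>\<Omega>\<close>
    and whose whole orbit avoids the errors. It is comeager because group and colours are
    countable.\<close>
  define G where "G = {x. ?c x \<in> \<Omega> \<and> (\<forall>\<gamma> n. f (shift \<gamma> x) = n \<longleftrightarrow> shift \<gamma> x \<in> U n)}"
  have "comeager G"
    unfolding comeager_def
  proof (rule meager_subset)
    \<comment> \<open>\<open>None\<close> indexes the points with code outside
      \<open>\<Omega>\<close>, and \<open>Some (\<gamma>, n)\<close> the error of colour
      \<open>n\<close> met at \<open>shift \<gamma> x\<close>.\<close>
    let ?M = "\<lambda>i. case i of None \<Rightarrow> - (?c -` \<Omega>)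
      | Some (\<gamma>, n) \<Rightarrow> shift \<gamma> -` ((f -` {n} - U n) \<union> (U n - f -` {n}))"
    show "meager (\<Union>i\<in>UNIV. ?M i)"
    proof (rule meager_UN)
      fix i :: "('g \<times> nat) option"
      show "meager (?M i)"
        using f U(2) meager_vimage_shift[OF U(2)]
        by (auto simp: baire_measurable_coloring_def comeager_def split: option.split)
    qed simp
    show "- G \<subseteq> (\<Union>i\<in>UNIV. ?M i)"
    proof
      fix x assume "x \<in> - G"
      then consider "?c x \<notin> \<Omega>" | \<gamma> n where "\<not> (f (shift \<gamma> x) = n \<longleftrightarrow> shift \<gamma> x \<in> U n)"
        by (auto simp: G_def)
      then show "x \<in> (\<Union>i\<in>UNIV. ?M i)"
      proof cases
        case 1
        then show ?thesis
          by (intro UN_I[of None]) auto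
      next
        case (2 \<gamma> n)
        then show ?thesis
          by (intro UN_I[of "Some (\<gamma>, n)"]) auto
      qed
    qed
  qed
  have c_shift: "?c (shift \<gamma> x) = shift \<gamma> (?c x)" for \<gamma> x
    by (simp add: coding_map_def shift_def fun_eq_iff add.assoc)
  have G_shift: "shift \<gamma> x \<in> G" if "x \<in> G" for \<gamma> x
    using that sub by (auto simp: G_def c_shift subshift_def shift_add[symmetric])
  define \<Omega>' where "\<Omega>' = closure (?c ` G)"
  have "subshift \<Omega>'"
    unfolding \<Omega>'_def
    by (rule subshift_closure) (use G_shift c_shift in \<open>force simp flip: c_shift\<close>)
  moreover have "\<Omega>' \<subseteq> \<Omega>"
    unfolding \<Omega>'_def using sub by (intro closure_minimal) (auto simp: G_def subshift_def)
  moreover have "subshift_join_property d \<Omega>'"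
  proof -
    \<comment> \<open>\<open>V \<phi>\<close> is the set on which the open sets \<open>U n\<close>
      display \<open>\<phi>\<close>; for points of \<open>G\<close> this is the actual colour
      pattern.\<close>
    define V where "V \<phi> = {x. \<forall>\<gamma> n. \<phi> \<gamma> = Some n \<longrightarrow> shift \<gamma> x \<in> U n}" for \<phi> :: "'g \<rightharpoonup> nat"
    have V_open: "open (V \<phi>)" if "finite (dom \<phi>)" for \<phi>
    proof -
      have "V \<phi> = (\<Inter>\<gamma>\<in>dom \<phi>. shift \<gamma> -` U (the (\<phi> \<gamma>)))"
        by (force simp: V_def)
      then show ?thesis
        using that U(1) by (auto intro!: open_INT open_vimage_shift)
    qed
    have V_shift: "y \<in> V (shift \<gamma> \<phi>) \<longleftrightarrow> shift (- \<gamma>) y \<in> V \<phi>" for y \<gamma> \<phi>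
    proof -
      have "y \<in> V (shift \<gamma> \<phi>) \<longleftrightarrow> (\<forall>\<alpha> n. \<phi> \<alpha> = Some n \<longrightarrow> shift (\<alpha> - \<gamma>) y \<in> U n)"
        unfolding V_def by (auto simp: shift_def[of \<gamma> \<phi>]) (metis add_diff_cancel)
      then show ?thesis
        by (simp add: V_def shift_add[symmetric])
    qed
    \<comment> \<open>Nonemptiness of \<open>V \<phi>\<close> suffices: being open, it then meets
      the comeager set \<open>G\<close>.\<close>
    have Fin_eq: "Fin \<Omega>' = {\<phi>. finite (dom \<phi>) \<and> V \<phi> \<noteq> {}}"
    proof (intro equalityI subsetI)
      fix \<phi> assume "\<phi> \<in> Fin \<Omega>'"
      then obtain x where x: "finite (dom \<phi>)" "x \<in> G" "\<forall>\<gamma>\<in>dom \<phi>. \<phi> \<gamma> = Some (?c x \<gamma>)"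
        unfolding \<Omega>'_def Fin_closure by (auto simp: Fin_iff)
      have "x \<in> V \<phi>"
        unfolding V_def
      proof (intro CollectI allI impI)
        fix \<gamma> n assume "\<phi> \<gamma> = Some n"
        then have "f (shift \<gamma> x) = n"
          using x(3) by (force simp: coding_map_def)
        then show "shift \<gamma> x \<in> U n"
          using x(2) by (auto simp: G_def)
      qed
      then show "\<phi> \<in> {\<phi>. finite (dom \<phi>) \<and> V \<phi> \<noteq> {}}"
        using x(1) by blast
    next
      fix \<phi> assume "\<phi> \<in> {\<phi>. finite (dom \<phi>) \<and> V \<phi> \<noteq> {}}"
      then have fin: "finite (dom \<phi>)" and "V \<phi> \<noteq> {}" by auto
      then obtain x where x: "x \<in> V \<phi>" "x \<in> G"
        using open_meets_comeager[OF V_open _ \<open>comeager G\<close>] by blast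
      have "\<forall>\<gamma>\<in>dom \<phi>. \<phi> \<gamma> = Some (?c x \<gamma>)"
      proof
        fix \<gamma> assume "\<gamma> \<in> dom \<phi>"
        then obtain n where n: "\<phi> \<gamma> = Some n" by blast
        then have "shift \<gamma> x \<in> U n"
          using x(1) by (simp add: V_def)
        then have "f (shift \<gamma> x) = n"
          using x(2) by (simp add: G_def)
        then show "\<phi> \<gamma> = Some (?c x \<gamma>)"
          using n by (simp add: coding_map_def)
      qed
      then show "\<phi> \<in> Fin \<Omega>'"
        using fin x(2) unfolding \<Omega>'_def Fin_closure Fin_iff by blast
    qed
    define near where "near \<phi> k \<gamma> \<longleftrightarrow> (\<exists>a\<in>dom \<phi>. d a \<gamma> \<le> real k)" for \<phi> :: "'g \<rightharpoonup> nat" and k \<gamma>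
    \<comment> \<open>\<open>B \<phi> k\<close> says that suitable values at distance at most
      \<open>k\<close> from the domain force \<open>\<phi>\<close>. The least such \<open>k\<close>
      will be the radius of \<open>\<phi>\<close>; natural numbers ensure that it exists.\<close>
    define B where "B \<phi> k \<longleftrightarrow> (\<exists>x. \<forall>y. (\<forall>\<gamma>. near \<phi> k \<gamma> \<longrightarrow> y \<gamma> = x \<gamma>) \<longrightarrow> y \<in> V \<phi>)" for \<phi> k
    define R where "R \<phi> = (LEAST k. B \<phi> k)" for \<phi>
    have B_ex: "\<exists>k. B \<phi> k" if \<phi>: "\<phi> \<in> Fin \<Omega>'" for \<phi>
    proof (cases "dom \<phi> = {}")
      \<comment> \<open>For the empty pattern no position is \<open>near\<close>, and
        \<open>V \<phi>\<close> is everything.\<close>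
      case True
      then have "V \<phi> = UNIV"
        by (auto simp: V_def)
      then show ?thesis
        by (simp add: B_def)
    next
      case False
      then obtain a where a: "a \<in> dom \<phi>" by blast
      have "open (V \<phi>)" "V \<phi> \<noteq> {}"
        using \<phi> V_open by (auto simp: Fin_eq)
      then obtain x where "x \<in> V \<phi>" by blast
      obtain S where S: "finite S" "\<forall>y. (\<forall>i\<in>S. y i = x i) \<longrightarrow> y \<in> V \<phi>"
        using open_fun_finite_support[OF \<open>open (V \<phi>)\<close> \<open>x \<in> V \<phi>\<close>] by blast
      obtain k where k: "Max (insert 0 (d a ` S)) \<le> real k"
        using real_arch_simple by blast
      have "near \<phi> k \<gamma>" if "\<gamma> \<in> S" for \<gamma>
        using that k S(1) a by (auto simp: near_def)
      then show ?thesis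
        using S(2) unfolding B_def by blast
    qed
    have B_shift: "B (shift \<gamma> \<phi>) k" if B: "B \<phi> k" for \<gamma> \<phi> k
    proof -
      obtain x where x: "\<And>y. (\<forall>\<delta>. near \<phi> k \<delta> \<longrightarrow> y \<delta> = x \<delta>) \<Longrightarrow> y \<in> V \<phi>"
        using B unfolding B_def by blast
      have "y \<in> V (shift \<gamma> \<phi>)" if y: "\<forall>\<delta>. near (shift \<gamma> \<phi>) k \<delta> \<longrightarrow> y \<delta> = shift \<gamma> x \<delta>" for y
        unfolding V_shift
      proof (rule x, intro allI impI)
        fix \<delta> assume "near \<phi> k \<delta>"
        then have "near (shift \<gamma> \<phi>) k (\<delta> - \<gamma>)"
          by (auto simp: near_def dom_shift dist_diff)
        then show "shift (- \<gamma>) y \<delta> = x \<delta>"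
          using y by (simp add: shift_def)
      qed
      then show ?thesis
        unfolding B_def by blast
    qed
    have B_shift_iff: "B (shift \<gamma> \<phi>) k \<longleftrightarrow> B \<phi> k" for \<gamma> \<phi> k
      using B_shift[of \<phi> k \<gamma>] B_shift[of "shift \<gamma> \<phi>" k "- \<gamma>"] by auto
    have "\<exists>x. \<phi> \<in> Fin \<Omega>' \<longrightarrow> (\<forall>y. (\<forall>\<gamma>. near \<phi> (R \<phi>) \<gamma> \<longrightarrow> y \<gamma> = x \<gamma>) \<longrightarrow> y \<in> V \<phi>)" for \<phi>
      using LeastI_ex[OF B_ex, of \<phi>] unfolding R_def B_def by blast
    then obtain X where X: "\<And>\<phi> y. \<phi> \<in> Fin \<Omega>' \<Longrightarrow> (\<forall>\<gamma>. near \<phi> (R \<phi>) \<gamma> \<longrightarrow> y \<gamma> = X \<phi> \<gamma>) \<Longrightarrow> y \<in> V \<phi>"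
      by metis
    show ?thesis
      unfolding subshift_join_property_def join_property_def
    proof (intro exI[of _ "\<lambda>\<phi>. real (R \<phi>)"] conjI allI ballI impI)
      fix \<gamma> \<phi> assume "\<phi> \<in> Fin \<Omega>'"
      show "real (R (shift \<gamma> \<phi>)) = real (R \<phi>)"
        by (simp add: R_def B_shift_iff)
    next
      fix \<phi>s assume "set \<phi>s \<subseteq> Fin \<Omega>' \<and>
        (\<forall>i<length \<phi>s. \<forall>j<length \<phi>s. i \<noteq> j \<longrightarrow> separated d (\<lambda>\<phi>. real (R \<phi>)) (\<phi>s ! i) (\<phi>s ! j))"
      then have \<phi>s: "set \<phi>s \<subseteq> Fin \<Omega>'"
        and sep': "\<And>i j. i < length \<phi>s \<Longrightarrow> j < length \<phi>s \<Longrightarrow> i \<noteq> j \<Longrightarrow>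
          separated d (\<lambda>\<phi>. real (R \<phi>)) (\<phi>s ! i) (\<phi>s ! j)"
        by auto
      have fin: "finite (dom \<phi>)" if "\<phi> \<in> set \<phi>s" for \<phi>
        using that \<phi>s by (auto simp: Fin_eq)
      \<comment> \<open>By the triangle inequality, a position near two different patterns
        contradicts their separation. The prescriptions thus live on disjoint sets.\<close>
      have unique: "\<phi> = \<phi>'"
        if *: "\<phi> \<in> set \<phi>s" "\<phi>' \<in> set \<phi>s" "near \<phi> (R \<phi>) \<gamma>" "near \<phi>' (R \<phi>') \<gamma>" for \<phi> \<phi>' \<gamma>
      proof (rule ccontr)
        assume "\<phi> \<noteq> \<phi>'"
        then have sep: "separated d (\<lambda>\<phi>. real (R \<phi>)) \<phi> \<phi>'"
          using *(1,2) sep' by (metis in_set_conv_nth)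
        obtain a b where ab: "a \<in> dom \<phi>" "b \<in> dom \<phi>'" "d a \<gamma> \<le> R \<phi>" "d b \<gamma> \<le> R \<phi>'"
          using * by (auto simp: near_def)
        have "d a b \<le> R \<phi> + R \<phi>'"
          using triangle[of a \<gamma> b] ab(3,4) by (simp add: commute[of \<gamma>])
        moreover have "R \<phi> + R \<phi>' < d a b"
          using sep ab separated_iff[OF fin[OF *(1)] fin[OF *(2)]] by auto
        ultimately show False by simp
      qed
      \<comment> \<open>Near a pattern, \<open>x\<close> copies the point that forces it. Far from
        all of them the choice yields an arbitrary value.\<close>
      define x where "x \<gamma> = X (SOME \<phi>. \<phi> \<in> set \<phi>s \<and> near \<phi> (R \<phi>) \<gamma>) \<gamma>" for \<gamma>
      have "x \<gamma> = X \<phi> \<gamma>" if "\<phi> \<in> set \<phi>s" "near \<phi> (R \<phi>) \<gamma>" for \<phi> \<gamma>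
      proof -
        have "(SOME \<phi>. \<phi> \<in> set \<phi>s \<and> near \<phi> (R \<phi>) \<gamma>) = \<phi>"
          using that unique by (intro some_equality) auto
        then show ?thesis
          by (simp add: x_def)
      qed
      then have x: "x \<in> V \<phi>" if "\<phi> \<in> set \<phi>s" for \<phi>
        using that \<phi>s by (intro X) auto
      have "x \<in> V (foldr (++) \<phi>s Map.empty)"
        using x unfolding V_def by (blast dest: foldr_map_add_SomeD)
      then show "foldr (++) \<phi>s Map.empty \<in> Fin \<Omega>'"
        using fin by (auto simp: Fin_eq dom_foldr_map_add)
    qed simp
  qed
  ultimately show ?thesis by blast
qed

section \<open>From local subshifts to the join property\<close>

lemma map_option_comp_foldr:
  "map_option \<rho> \<circ> foldr (++) \<phi>s Map.empty = foldr (++) (map (\<lambda>\<phi>. map_option \<rho> \<circ> \<phi>) \<phi>s) Map.empty"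
proof (induction \<phi>s)
  case (Cons \<phi> \<phi>s)
  have "map_option \<rho> \<circ> (\<phi> ++ \<psi>) = (map_option \<rho> \<circ> \<phi>) ++ (map_option \<rho> \<circ> \<psi>)" for \<psi>
    by (auto simp: fun_eq_iff map_add_def split: option.split)
  with Cons.IH show ?case
    by (simp add: comp_def)
qed (simp add: fun_eq_iff)

text \<open>\<open>map_option\<close> keeps domains, so a pattern of the image lifts to a preimage
  point restricted to its domain.\<close>

lemma Fin_image_comp: "Fin ((\<lambda>\<omega>. \<rho> \<circ> \<omega>) ` \<Omega>) = (\<lambda>\<phi>. map_option \<rho> \<circ> \<phi>) ` Fin \<Omega>"
proof (intro equalityI subsetI)
  fix \<psi> assume "\<psi> \<in> Fin ((\<lambda>\<omega>. \<rho> \<circ> \<omega>) ` \<Omega>)"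
  then obtain \<omega> where \<omega>: "finite (dom \<psi>)" "\<omega> \<in> \<Omega>" "\<forall>\<gamma>\<in>dom \<psi>. \<psi> \<gamma> = Some (\<rho> (\<omega> \<gamma>))"
    by (auto simp: Fin_iff)
  define \<phi> where "\<phi> = (Some \<circ> \<omega>) |` dom \<psi>"
  have "dom \<phi> = dom \<psi>"
    by (auto simp: \<phi>_def dom_def restrict_map_def)
  moreover have "\<forall>\<gamma>\<in>dom \<psi>. \<phi> \<gamma> = Some (\<omega> \<gamma>)"
    by (simp add: \<phi>_def)
  ultimately have "\<phi> \<in> Fin \<Omega>"
    using \<omega>(1,2) unfolding Fin_iff by metis
  moreover have "\<psi> = map_option \<rho> \<circ> \<phi>"
    using \<omega>(3) by (auto simp: \<phi>_def fun_eq_iff restrict_map_def dom_def)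
  ultimately show "\<psi> \<in> (\<lambda>\<phi>. map_option \<rho> \<circ> \<phi>) ` Fin \<Omega>"
    by blast
next
  fix \<psi> assume "\<psi> \<in> (\<lambda>\<phi>. map_option \<rho> \<circ> \<phi>) ` Fin \<Omega>"
  then obtain \<phi> where \<phi>: "\<psi> = map_option \<rho> \<circ> \<phi>" "\<phi> \<in> Fin \<Omega>" by blast
  then obtain \<omega> where \<omega>: "finite (dom \<phi>)" "\<omega> \<in> \<Omega>" "\<forall>\<gamma>\<in>dom \<phi>. \<phi> \<gamma> = Some (\<omega> \<gamma>)"
    by (auto simp: Fin_iff)
  have "dom \<psi> = dom \<phi>"
    by (auto simp: \<phi>(1) dom_def)
  then have "finite (dom \<psi>)" "\<forall>\<gamma>\<in>dom \<psi>. \<psi> \<gamma> = Some ((\<rho> \<circ> \<omega>) \<gamma>)"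
    using \<omega>(1,3) by (auto simp: \<phi>(1))
  then show "\<psi> \<in> Fin ((\<lambda>\<omega>. \<rho> \<circ> \<omega>) ` \<Omega>)"
    using \<omega>(2) unfolding Fin_iff by blast
qed

text \<open>Image patterns are lifted to \<open>Fin \<Omega>\<close>, joined there by locality and
  mapped back by \<open>\<rho>\<close>. For \<open>\<rho>\<close> the identity this is the join
  property of \<open>\<Omega>\<close> itself.\<close>

lemma local_image_join_property:
  fixes d :: "'g::group_add \<Rightarrow> 'g \<Rightarrow> real"
  assumes d: "proper_right_invariant_metric d" and sub: "subshift \<Omega>" and loc: "subshift_local d \<Omega>"
  shows "join_property d ((\<lambda>\<phi>. map_option \<rho> \<circ> \<phi>) ` Fin \<Omega>)"
proof -
  interpret Metric_space UNIV d
    using d by (rule proper_metricD)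
  obtain r where r: "\<forall>n. 0 \<le> r n" "{\<phi> \<in> fin_maps. locally_in d r (Fin \<Omega>) \<phi>} = Fin \<Omega>"
    using loc unfolding subshift_local_def local_ideal_def by blast
  define img :: "('g \<rightharpoonup> nat) \<Rightarrow> 'g \<rightharpoonup> nat" where "img = (\<lambda>\<phi>. map_option \<rho> \<circ> \<phi>)"
  \<comment> \<open>A pattern can have several lifts with different radii. The least integer bound
    over all lifts depends on the image pattern alone and is invariant, as lifts can be
    shifted.\<close>
  define B where "B \<psi> n \<longleftrightarrow> (\<exists>\<phi>\<in>Fin \<Omega>. \<psi> = img \<phi> \<and> (\<forall>\<gamma>\<in>dom \<phi>. r (the (\<phi> \<gamma>)) \<le> real n))" for \<psi> n
  define R where "R \<psi> = (LEAST n. B \<psi> n)" for \<psi>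
  have dom_img: "dom (img \<phi>) = dom \<phi>" for \<phi>
    by (auto simp: img_def dom_def)
  have B_ex: "\<exists>n. B \<psi> n" if \<psi>: "\<psi> \<in> img ` Fin \<Omega>" for \<psi>
  proof -
    obtain \<phi> where \<phi>: "\<phi> \<in> Fin \<Omega>" "\<psi> = img \<phi>"
      using \<psi> by blast
    obtain n where n: "Max (insert 0 ((\<lambda>\<gamma>. r (the (\<phi> \<gamma>))) ` dom \<phi>)) \<le> real n"
      using real_arch_simple by blast
    have "finite (dom \<phi>)"
      using \<phi>(1) by (simp add: Fin_iff)
    then have "\<forall>\<gamma>\<in>dom \<phi>. r (the (\<phi> \<gamma>)) \<le> real n"
      using n by (simp add: Max_le_iff)
    then show ?thesis
      using \<phi> unfolding B_def by blast
  qed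
  have B_shift: "B (shift \<gamma> \<psi>) n" if B: "B \<psi> n" for \<gamma> \<psi> n
  proof -
    obtain \<phi> where \<phi>: "\<phi> \<in> Fin \<Omega>" "\<psi> = img \<phi>" "\<forall>\<gamma>\<in>dom \<phi>. r (the (\<phi> \<gamma>)) \<le> real n"
      using B unfolding B_def by blast
    have "shift \<gamma> \<phi> \<in> Fin \<Omega>" "shift \<gamma> \<psi> = img (shift \<gamma> \<phi>)"
      using \<phi> Fin_shift[OF sub] by (auto simp: shift_def img_def)
    moreover have "\<forall>\<delta>\<in>dom (shift \<gamma> \<phi>). r (the (shift \<gamma> \<phi> \<delta>)) \<le> real n"
      using \<phi>(3) by (simp add: dom_shift) (simp add: shift_def)
    ultimately show ?thesis
      unfolding B_def by blast
  qed
  have B_shift_iff: "B (shift \<gamma> \<psi>) n \<longleftrightarrow> B \<psi> n" for \<gamma> \<psi> n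
    using B_shift[of \<psi> n \<gamma>] B_shift[of "shift \<gamma> \<psi>" n "- \<gamma>"] by auto
  have "\<exists>\<phi>. \<psi> \<in> img ` Fin \<Omega> \<longrightarrow> \<phi> \<in> Fin \<Omega> \<and> \<psi> = img \<phi> \<and> (\<forall>\<gamma>\<in>dom \<phi>. r (the (\<phi> \<gamma>)) \<le> R \<psi>)" for \<psi>
    using LeastI_ex[OF B_ex, of \<psi>] unfolding R_def B_def by blast
  \<comment> \<open>\<open>F\<close> picks a lift whose radii are all at most
    \<open>R\<close>.\<close>
  then obtain F where F: "\<And>\<psi>. \<psi> \<in> img ` Fin \<Omega> \<Longrightarrow> F \<psi> \<in> Fin \<Omega>"
      "\<And>\<psi>. \<psi> \<in> img ` Fin \<Omega> \<Longrightarrow> img (F \<psi>) = \<psi>"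
      "\<And>\<psi> \<gamma>. \<psi> \<in> img ` Fin \<Omega> \<Longrightarrow> \<gamma> \<in> dom (F \<psi>) \<Longrightarrow> r (the (F \<psi> \<gamma>)) \<le> R \<psi>"
    by metis
  have domF: "dom (F \<psi>) = dom \<psi>" if "\<psi> \<in> img ` Fin \<Omega>" for \<psi>
    using F(2)[OF that] dom_img by metis
  have fin: "finite (dom \<psi>)" if "\<psi> \<in> img ` Fin \<Omega>" for \<psi>
    using that by (auto simp: dom_img Fin_iff)
  have "join_property d (img ` Fin \<Omega>)"
    unfolding join_property_def
  proof (intro exI[of _ "\<lambda>\<psi>. real (R \<psi>)"] conjI allI ballI impI)
    fix \<gamma> \<psi> assume "\<psi> \<in> img ` Fin \<Omega>"
    show "real (R (shift \<gamma> \<psi>)) = real (R \<psi>)"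
      by (simp add: R_def B_shift_iff)
  next
    fix \<psi>s assume "set \<psi>s \<subseteq> img ` Fin \<Omega> \<and>
      (\<forall>i<length \<psi>s. \<forall>j<length \<psi>s. i \<noteq> j \<longrightarrow> separated d (\<lambda>\<psi>. real (R \<psi>)) (\<psi>s ! i) (\<psi>s ! j))"
    then have \<psi>s: "set \<psi>s \<subseteq> img ` Fin \<Omega>"
      and sep': "\<And>i j. i < length \<psi>s \<Longrightarrow> j < length \<psi>s \<Longrightarrow> i \<noteq> j \<Longrightarrow>
        separated d (\<lambda>\<psi>. real (R \<psi>)) (\<psi>s ! i) (\<psi>s ! j)"
      by auto
    have sep: "R \<psi> + R \<psi>' < d a b"
      if *: "\<psi> \<in> set \<psi>s" "\<psi>' \<in> set \<psi>s" "\<psi> \<noteq> \<psi>'" "a \<in> dom \<psi>" "b \<in> dom \<psi>'" for \<psi> \<psi>' a b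
    proof -
      have "separated d (\<lambda>\<psi>. real (R \<psi>)) \<psi> \<psi>'"
        using *(1-3) sep' by (metis in_set_conv_nth)
      then show ?thesis
        using * fin \<psi>s by (subst (asm) separated_iff) auto
    qed
    define \<Phi> where "\<Phi> = foldr (++) (map F \<psi>s) Map.empty"
    have \<Phi>_eq: "\<Phi> a = F \<psi> a" if "\<psi> \<in> set \<psi>s" "a \<in> dom \<psi>" for \<psi> a
      unfolding \<Phi>_def
    proof (rule foldr_map_add_eq)
      fix \<phi> \<phi>' b assume "\<phi> \<in> set (map F \<psi>s)" "\<phi>' \<in> set (map F \<psi>s)" "b \<in> dom \<phi>" "b \<in> dom \<phi>'"
      then obtain \<psi> \<psi>' where *: "\<psi> \<in> set \<psi>s" "\<psi>' \<in> set \<psi>s" "\<phi> = F \<psi>" "\<phi>' = F \<psi>'"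
          "b \<in> dom (F \<psi>)" "b \<in> dom (F \<psi>')"
        by auto
      then have "b \<in> dom \<psi>" "b \<in> dom \<psi>'"
        using domF[of \<psi>] domF[of \<psi>'] \<psi>s by blast+
      then have "\<psi> = \<psi>'"
        using sep[of \<psi> \<psi>' b b] *(1,2) by auto
      then show "\<phi> b = \<phi>' b"
        using * by simp
    next
      show "F \<psi> \<in> set (map F \<psi>s)" "a \<in> dom (F \<psi>)"
        using that domF[of \<psi>] \<psi>s by auto
    qed
    have dom\<Phi>: "dom \<Phi> = (\<Union>\<psi>\<in>set \<psi>s. dom \<psi>)"
    proof -
      have "dom \<Phi> = (\<Union>\<psi>\<in>set \<psi>s. dom (F \<psi>))"
        by (simp add: \<Phi>_def dom_foldr_map_add)
      also have "\<dots> = (\<Union>\<psi>\<in>set \<psi>s. dom \<psi>)"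
        using domF \<psi>s by (intro SUP_cong) blast+
      finally show ?thesis .
    qed
    \<comment> \<open>By separation, a ball of radius at most \<open>R \<psi>\<close> around a point
      of \<open>dom \<psi>\<close> meets no other domain. What \<open>\<Phi>\<close> shows there is
      part of the lift \<open>F \<psi>\<close>, and locality then puts all of \<open>\<Phi>\<close>
      into \<open>Fin \<Omega>\<close>.\<close>
    have "locally_in d r (Fin \<Omega>) \<Phi>"
      unfolding locally_in_def
    proof
      fix \<gamma> assume "\<gamma> \<in> dom \<Phi>"
      then obtain \<psi> where \<psi>: "\<psi> \<in> set \<psi>s" "\<gamma> \<in> dom \<psi>"
        by (auto simp: dom\<Phi>)
      show "\<Phi> |` (dom \<Phi> \<inter> mcball \<gamma> (r (the (\<Phi> \<gamma>)))) \<in> Fin \<Omega>"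
      proof (rule Fin_restrict[where \<phi> = "F \<psi>"])
        show "F \<psi> \<in> Fin \<Omega>"
          using F \<psi> \<psi>s by auto
        show "\<Phi> |` (dom \<Phi> \<inter> mcball \<gamma> (r (the (\<Phi> \<gamma>)))) \<subseteq>\<^sub>m F \<psi>"
          unfolding map_le_iff_eq
        proof
          fix \<delta> assume "\<delta> \<in> dom (\<Phi> |` (dom \<Phi> \<inter> mcball \<gamma> (r (the (\<Phi> \<gamma>)))))"
          then have \<delta>: "\<delta> \<in> dom \<Phi>" "d \<gamma> \<delta> \<le> r (the (\<Phi> \<gamma>))"
            by (auto simp: restrict_map_def split: if_splits)
          then obtain \<psi>' where \<psi>': "\<psi>' \<in> set \<psi>s" "\<delta> \<in> dom \<psi>'"
            by (auto simp: dom\<Phi>)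
          have "d \<gamma> \<delta> \<le> R \<psi>"
            using \<delta>(2) \<Phi>_eq[OF \<psi>] F(3)[of \<psi> \<gamma>] \<psi> \<psi>s domF by force
          then have "\<psi> = \<psi>'"
            using sep[OF \<psi>(1) \<psi>'(1) _ \<psi>(2) \<psi>'(2)] by force
          then show "(\<Phi> |` (dom \<Phi> \<inter> mcball \<gamma> (r (the (\<Phi> \<gamma>))))) \<delta> = F \<psi> \<delta>"
            using \<Phi>_eq[OF \<psi>'] \<delta> by (simp add: restrict_map_def)
        qed
      qed
    qed
    moreover have "\<Phi> \<in> fin_maps"
      using fin \<psi>s by (auto simp: fin_maps_def dom\<Phi>)
    ultimately have "\<Phi> \<in> Fin \<Omega>"
      using r(2) by blast
    moreover have "map (\<lambda>\<phi>. map_option \<rho> \<circ> \<phi>) (map F \<psi>s) = \<psi>s"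
      using F(2) \<psi>s unfolding img_def[symmetric] by (simp add: map_idI subset_iff)
    then have "img \<Phi> = foldr (++) \<psi>s Map.empty"
      unfolding \<Phi>_def img_def map_option_comp_foldr by simp
    ultimately show "foldr (++) \<psi>s Map.empty \<in> img ` Fin \<Omega>"
      by (metis imageI)
  qed simp
  then show ?thesis
    by (simp add: img_def)
qed

text \<open>The image of \<open>\<Omega>'\<close> under the reduction is invariant and lies in
  \<open>\<Omega>\<close>; its closure has the same finite patterns, so their join property carries
  over.\<close>

theorem local_imp_join:
  assumes "proper_right_invariant_metric d" "subshift \<Omega>" "subshift \<Omega>'" "subshift_local d \<Omega>'"
    and "reducible_to \<Omega> \<Omega>'"
  shows "\<exists>\<Omega>''. subshift \<Omega>'' \<and> subshift_join_property d \<Omega>'' \<and> \<Omega>'' \<subseteq> \<Omega>"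
proof -
  obtain \<rho> where \<rho>: "\<forall>\<omega>\<in>\<Omega>'. \<rho> \<circ> \<omega> \<in> \<Omega>"
    using assms(5) unfolding reducible_to_def by blast
  let ?A = "(\<lambda>\<omega>. \<rho> \<circ> \<omega>) ` \<Omega>'"
  have "subshift (closure ?A)"
  proof (rule subshift_closure)
    fix \<gamma> \<omega> assume "\<omega> \<in> ?A"
    then obtain \<omega>' where "\<omega>' \<in> \<Omega>'" "\<omega> = \<rho> \<circ> \<omega>'" by blast
    then show "shift \<gamma> \<omega> \<in> ?A"
      using assms(3) by (intro image_eqI[of _ _ "shift \<gamma> \<omega>'"]) (auto simp: shift_def subshift_def)
  qed
  moreover have "subshift_join_property d (closure ?A)"
    unfolding subshift_join_property_def Fin_closure Fin_image_comp
    using assms(1,3,4) by (rule local_image_join_property)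
  moreover have "closure ?A \<subseteq> \<Omega>"
    using \<rho> assms(2) by (intro closure_minimal) (auto simp: subshift_def)
  ultimately show ?thesis by blast
qed

section \<open>From the join property to local subshifts\<close>

lemma finite_map_as_map_of:
  assumes "finite (dom \<phi>)"
  obtains xs where "map_of xs = \<phi>"
proof -
  obtain as where as: "set as = dom \<phi>"
    using assms finite_list by blast
  have "map_of (map (\<lambda>a. (a, the (\<phi> a))) as) = \<phi>"
    by (auto simp: fun_eq_iff map_of_map_restrict as domIff restrict_map_def)
  then show ?thesis ..
qed

text \<open>Lists of pairs over a countable group are countable, so numbers can name all patterns of
  finite domain. A pattern has several names.\<close>

definition decode :: "nat \<Rightarrow> 'g::countable \<rightharpoonup> nat" where
  "decode n = map_of (from_nat n)"

lemma decode_surj: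
  assumes "finite (dom \<phi>)"
  shows "\<exists>n. decode n = \<phi>"
  using finite_map_as_map_of[OF assms] unfolding decode_def by (metis from_nat_to_nat)

section \<open>Labels that code patterns, and their conflicts\<close>

context joinable
begin

text \<open>
  A label at \<open>\<gamma>\<close> codes the pattern \<open>\<Psi> \<gamma>\<close>, translated so that \<open>\<gamma>\<close> becomes the identity.
\<close>

definition valid :: "nat \<Rightarrow> bool" where
  "valid n \<longleftrightarrow> decode n \<in> Fin \<Omega> \<and> (0 :: 'g) \<in> dom (decode n)"

text \<open>\<open>shift (- \<gamma>)\<close> moves a decoded pattern from the identity to its
  position \<open>\<gamma>\<close>.\<close>

definition conflict_free :: "('g \<rightharpoonup> nat) \<Rightarrow> bool" where
  "conflict_free \<phi> \<longleftrightarrow> (\<forall>\<gamma> n. \<phi> \<gamma> = Some n \<longrightarrow> valid n) \<and>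
     (\<forall>\<gamma> n \<delta> m. \<phi> \<gamma> = Some n \<longrightarrow> \<phi> \<delta> = Some m \<longrightarrow>
        compatible (shift (- \<gamma>) (decode n)) (shift (- \<delta>) (decode m)))"

lemma mem_dom_shift: "\<delta> \<in> dom (shift \<gamma> \<phi>) \<longleftrightarrow> \<delta> + \<gamma> \<in> dom \<phi>"
  by (auto simp: shift_def dom_def)

lemma conflict_free_le: "conflict_free \<psi> \<Longrightarrow> \<phi> \<subseteq>\<^sub>m \<psi> \<Longrightarrow> conflict_free \<phi>"
  unfolding conflict_free_def map_le_def by (metis domI)

lemma conflict_free_shift:
  assumes "conflict_free \<phi>"
  shows "conflict_free (shift \<gamma> \<phi>)"
proof -
  have eq: "shift (- \<alpha>) \<psi> = shift \<gamma> (shift (- (\<alpha> + \<gamma>)) \<psi>)" for \<alpha> and \<psi> :: "'g \<rightharpoonup> nat"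
    by (simp only: shift_add[symmetric] minus_add add_minus_cancel)
  show ?thesis
    unfolding conflict_free_def
  proof (intro conjI allI impI)
    fix \<alpha> n \<beta> m assume "shift \<gamma> \<phi> \<alpha> = Some n" "shift \<gamma> \<phi> \<beta> = Some m"
    then have *: "\<phi> (\<alpha> + \<gamma>) = Some n" "\<phi> (\<beta> + \<gamma>) = Some m"
      by (auto simp: shift_def)
    then have "valid n" "valid m"
        "compatible (shift (- (\<alpha> + \<gamma>)) (decode n)) (shift (- (\<beta> + \<gamma>)) (decode m))"
      using assms unfolding conflict_free_def by blast+
    then show "compatible (shift (- \<alpha>) (decode n)) (shift (- \<beta>) (decode m))"
      unfolding eq[of \<alpha>] eq[of \<beta>] by (auto simp: valid_def intro!: compatible_shift Fin_shift')
  qed (use assms in \<open>auto simp: conflict_free_def shift_def\<close>)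
qed

text \<open>Patterns in conflict are not separated, so some points \<open>a + \<gamma>\<close> and
  \<open>b + \<delta>\<close> of them are close; the sums bound the distances from these points to
  \<open>\<gamma>\<close> and \<open>\<delta>\<close>. The bound is arranged as one term for each
  label.\<close>

lemma conflict_near:
  assumes "valid n" "valid m" "\<not> compatible (shift (- \<gamma>) (decode n)) (shift (- \<delta>) (decode m))"
  shows "d \<gamma> \<delta> \<le> R (decode n) + (\<Sum>a\<in>dom (decode n). d a 0) + (R (decode m) + (\<Sum>a\<in>dom (decode m). d a 0))"
proof -
  have n: "decode n \<in> Fin \<Omega>" and m: "decode m \<in> Fin \<Omega>"
    using assms by (auto simp: valid_def)
  have "\<not> separated d R (shift (- \<gamma>) (decode n)) (shift (- \<delta>) (decode m))"
    using assms(3) by (simp add: compatible_def)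
  then obtain a b where ab: "a \<in> dom (decode n)" "b \<in> dom (decode m)" "d (a + \<gamma>) (b + \<delta>) \<le> R (decode n) + R (decode m)"
    using n m by (auto simp: separated_Fin_iff Fin_shift' R_shift dom_shift not_less)
  have le: "d x 0 \<le> (\<Sum>a\<in>dom \<phi>. d a 0)" if "\<phi> \<in> Fin \<Omega>" "x \<in> dom \<phi>" for x and \<phi> :: "'g \<rightharpoonup> nat"
    using that by (intro member_le_sum) (auto simp: finite_dom)
  have inv: "d (x + \<epsilon>) \<epsilon> = d x 0" for x \<epsilon>
    using proper_metricD(2)[OF proper, of x \<epsilon> 0] by simp
  have "d \<gamma> \<delta> \<le> d \<gamma> (a + \<gamma>) + d (a + \<gamma>) (b + \<delta>) + d (b + \<delta>) \<delta>"
    using triangle[of \<gamma> "a + \<gamma>" \<delta>] triangle[of "a + \<gamma>" "b + \<delta>" \<delta>] by simp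
  also have "\<dots> \<le> (\<Sum>a\<in>dom (decode n). d a 0) + (R (decode n) + R (decode m)) + (\<Sum>a\<in>dom (decode m). d a 0)"
    using le[OF n ab(1)] le[OF m ab(2)] ab(3) by (intro add_mono) (auto simp: inv commute[of \<gamma>])
  finally show ?thesis by simp
qed

text \<open>The join of all patterns placed so far, enlarged to contain \<open>\<gamma>\<close>,
  becomes the pattern at \<open>\<gamma>\<close>. It contains the others, so no conflict
  arises.\<close>

lemma conflict_free_extend:
  assumes "conflict_free \<phi>" "finite (dom \<phi>)" "\<gamma> \<notin> dom \<phi>"
  shows "\<exists>n. conflict_free (\<phi>(\<gamma> \<mapsto> n))"
proof -
  let ?Q = "(\<lambda>\<delta>. shift (- \<delta>) (decode (the (\<phi> \<delta>)))) ` dom \<phi>"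
  have val: "valid n" if "\<phi> \<delta> = Some n" for \<delta> n
    using that assms(1) by (auto simp: conflict_free_def)
  have comp: "compatible (shift (- \<delta>) (decode n)) (shift (- \<epsilon>) (decode m))" if "\<phi> \<delta> = Some n" "\<phi> \<epsilon> = Some m" for \<delta> n \<epsilon> m
    using that assms(1) by (auto simp: conflict_free_def)
  have "finite ?Q" "?Q \<subseteq> Fin \<Omega>"
    using assms(2) val by (auto simp: valid_def intro!: Fin_shift')
  moreover have "compatible \<psi> \<psi>'" if "\<psi> \<in> ?Q" "\<psi>' \<in> ?Q" for \<psi> \<psi>'
    using that comp by auto
  ultimately obtain \<Phi> where \<Phi>: "\<Phi> \<in> Fin \<Omega>" "\<forall>\<psi>\<in>?Q. \<psi> \<subseteq>\<^sub>m \<Phi>" "\<gamma> \<in> dom \<Phi>"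
    using join_compatible_extend[of ?Q \<gamma>] by blast
  have "shift \<gamma> \<Phi> \<in> Fin \<Omega>"
    using \<Phi>(1) by (rule Fin_shift')
  then obtain n where n: "decode n = shift \<gamma> \<Phi>"
    using decode_surj finite_dom by blast
  have "valid n"
    using n \<open>shift \<gamma> \<Phi> \<in> Fin \<Omega>\<close> \<Phi>(3) by (simp add: valid_def mem_dom_shift)
  moreover have "shift (- \<delta>) (decode m) \<subseteq>\<^sub>m \<Phi>" if "\<phi> \<delta> = Some m" for \<delta> m
    using that by (intro \<Phi>(2)[rule_format]) force
  ultimately have "conflict_free (\<phi>(\<gamma> \<mapsto> n))"
    using val comp assms(3) unfolding conflict_free_def by (auto simp: n compatible_def)
  then show ?thesis ..
qed

text \<open>The unlabelled elements receive labels one after another, in the order given by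
  \<open>idx\<close>.\<close>

lemma conflict_free_total_extension:
  assumes "conflict_free \<phi>" "finite (dom \<phi>)"
  shows "\<exists>\<omega>. conflict_free (Some \<circ> \<omega>) \<and> \<phi> \<subseteq>\<^sub>m (Some \<circ> \<omega>)"
proof -
  define idx :: "'g \<Rightarrow> nat" where "idx = to_nat"
  have inj_idx: "inj idx"
    by (simp add: idx_def)
  define restr where "restr f k = (\<lambda>\<gamma>. if \<gamma> \<in> dom \<phi> then \<phi> \<gamma> else if idx \<gamma> < k then Some (f \<gamma>) else None)"
    for f :: "'g \<Rightarrow> nat" and k
  have finite_restr: "finite (dom (restr f k))" for f k
  proof (rule finite_subset)
    show "dom (restr f k) \<subseteq> dom \<phi> \<union> idx -` {..<k}"
      by (auto simp: restr_def split: if_splits)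
    show "finite (dom \<phi> \<union> idx -` {..<k})"
      using assms(2) inj_idx by (auto intro: finite_vimageI)
  qed
  \<comment> \<open>Each choice depends on the labels of smaller index. It is conditional on their
    being conflict free, so that it can be made for every \<open>f\<close>; the induction for
    \<open>cf\<close> discharges the condition.\<close>
  have "\<exists>f. \<forall>\<gamma>. \<gamma> \<notin> dom \<phi> \<longrightarrow> conflict_free (restr f (idx \<gamma>)) \<longrightarrow>
      conflict_free ((restr f (idx \<gamma>))(\<gamma> \<mapsto> f \<gamma>))"
  proof (rule dependent_wf_choice[where R = "Wellfounded.measure idx" and P = "\<lambda>f \<gamma> n. \<gamma> \<notin> dom \<phi> \<longrightarrow> conflict_free (restr f (idx \<gamma>)) \<longrightarrow>
      conflict_free ((restr f (idx \<gamma>))(\<gamma> \<mapsto> n))"])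
    fix f g :: "'g \<Rightarrow> nat" and \<gamma> n assume "\<And>\<delta>. (\<delta>, \<gamma>) \<in> Wellfounded.measure idx \<Longrightarrow> f \<delta> = g \<delta>"
    then have "restr f (idx \<gamma>) = restr g (idx \<gamma>)"
      by (auto simp: restr_def)
    then show "(\<gamma> \<notin> dom \<phi> \<longrightarrow> conflict_free (restr f (idx \<gamma>)) \<longrightarrow> conflict_free ((restr f (idx \<gamma>))(\<gamma> \<mapsto> n)))
        = (\<gamma> \<notin> dom \<phi> \<longrightarrow> conflict_free (restr g (idx \<gamma>)) \<longrightarrow> conflict_free ((restr g (idx \<gamma>))(\<gamma> \<mapsto> n)))"
      by simp
  next
    fix \<gamma> and f :: "'g \<Rightarrow> nat"
    show "\<exists>n. \<gamma> \<notin> dom \<phi> \<longrightarrow> conflict_free (restr f (idx \<gamma>)) \<longrightarrow> conflict_free ((restr f (idx \<gamma>))(\<gamma> \<mapsto> n))"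
    proof (cases "\<gamma> \<in> dom \<phi>")
      case False
      then have "\<gamma> \<notin> dom (restr f (idx \<gamma>))"
        by (auto simp: restr_def dom_def)
      then show ?thesis
        using conflict_free_extend[OF _ finite_restr] by blast
    qed auto
  qed simp
  then obtain f where f: "\<And>\<gamma>. \<gamma> \<notin> dom \<phi> \<Longrightarrow> conflict_free (restr f (idx \<gamma>)) \<Longrightarrow>
      conflict_free ((restr f (idx \<gamma>))(\<gamma> \<mapsto> f \<gamma>))"
    by blast
  have cf: "conflict_free (restr f k)" for k
  proof (induction k)
    case 0
    have "restr f 0 = \<phi>"
      by (auto simp: restr_def fun_eq_iff dom_def)
    then show ?case
      using assms(1) by simp
  next
    case (Suc k)
    show ?case
    proof (cases "\<exists>\<gamma>. \<gamma> \<notin> dom \<phi> \<and> idx \<gamma> = k")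
      case True
      then obtain \<gamma> where \<gamma>: "\<gamma> \<notin> dom \<phi>" "idx \<gamma> = k" by blast
      have "restr f (Suc k) = (restr f k)(\<gamma> \<mapsto> f \<gamma>)"
        using \<gamma> injD[OF inj_idx] by (auto simp: restr_def fun_eq_iff less_Suc_eq)
      then show ?thesis
        using f[OF \<gamma>(1)] Suc.IH \<gamma>(2) by metis
    next
      case False
      then have "restr f (Suc k) = restr f k"
        by (auto simp: restr_def fun_eq_iff less_Suc_eq)
      then show ?thesis
        using Suc.IH by simp
    qed
  qed
  define \<omega> where "\<omega> \<gamma> = (if \<gamma> \<in> dom \<phi> then the (\<phi> \<gamma>) else f \<gamma>)" for \<gamma>
  have eq: "restr f k \<gamma> = Some (\<omega> \<gamma>)" if "idx \<gamma> < k" for k \<gamma>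
    using that by (auto simp: restr_def \<omega>_def)
  have "conflict_free (Some \<circ> \<omega>)"
    unfolding conflict_free_def
  proof (intro conjI allI impI)
    fix \<gamma> n assume "(Some \<circ> \<omega>) \<gamma> = Some n"
    then have "restr f (Suc (idx \<gamma>)) \<gamma> = Some n"
      by (simp add: eq)
    then show "valid n"
      using cf unfolding conflict_free_def by blast
  next
    fix \<gamma> n \<delta> m assume "(Some \<circ> \<omega>) \<gamma> = Some n" "(Some \<circ> \<omega>) \<delta> = Some m"
    \<comment> \<open>Any two labels occur together at a finite stage; \<open>Suc\<close> is there
      because \<open>restr f k\<close> covers only indices below \<open>k\<close>.\<close>
    then have "restr f (Suc (idx \<gamma> + idx \<delta>)) \<gamma> = Some n" "restr f (Suc (idx \<gamma> + idx \<delta>)) \<delta> = Some m"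
      by (simp_all add: eq)
    then show "compatible (shift (- \<gamma>) (decode n)) (shift (- \<delta>) (decode m))"
      using cf unfolding conflict_free_def by blast
  qed
  moreover have "\<phi> \<subseteq>\<^sub>m (Some \<circ> \<omega>)"
    by (auto simp: map_le_def \<omega>_def)
  ultimately show ?thesis by blast
qed

end

theorem join_imp_local:
  fixes d :: "'g::{group_add,countable} \<Rightarrow> 'g \<Rightarrow> real"
  assumes "proper_right_invariant_metric d" "subshift \<Omega>'" "subshift_join_property d \<Omega>'" "\<Omega>' \<subseteq> \<Omega>"
  shows "\<exists>\<Omega>''. subshift \<Omega>'' \<and> subshift_local d \<Omega>'' \<and> reducible_to \<Omega> \<Omega>''"
proof -
  obtain R where "joinable d \<Omega>' R"
    using subshift_join_propertyE assms(1-3) by blast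
  then interpret joinable d \<Omega>' R .
  define \<Omega>'' where "\<Omega>'' = {\<omega>. conflict_free (Some \<circ> \<omega>)}"
  have sub: "subshift \<Omega>''"
  proof -
    have "\<omega> \<in> \<Omega>''" if "\<omega> \<in> closure \<Omega>''" for \<omega>
    proof -
      \<comment> \<open>\<open>conflict_free\<close> constrains at most two positions at a time, so
        agreement on pairs gives closedness.\<close>
      have *: "\<exists>\<omega>'\<in>\<Omega>''. \<omega>' \<gamma> = \<omega> \<gamma> \<and> \<omega>' \<delta> = \<omega> \<delta>" for \<gamma> \<delta>
        using that[unfolded closure_fun_nat, rule_format, of "{\<gamma>, \<delta>}"] by auto
      show ?thesis
        unfolding \<Omega>''_def mem_Collect_eq conflict_free_def
      proof (intro conjI allI impI)
        fix \<gamma> n assume "(Some \<circ> \<omega>) \<gamma> = Some n"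
        with *[of \<gamma> \<gamma>] obtain \<omega>' where "\<omega>' \<in> \<Omega>''" "(Some \<circ> \<omega>') \<gamma> = Some n" by auto
        then show "valid n"
          unfolding \<Omega>''_def mem_Collect_eq conflict_free_def by blast
      next
        fix \<gamma> n \<delta> m assume "(Some \<circ> \<omega>) \<gamma> = Some n" "(Some \<circ> \<omega>) \<delta> = Some m"
        with *[of \<gamma> \<delta>] obtain \<omega>' where "\<omega>' \<in> \<Omega>''" "(Some \<circ> \<omega>') \<gamma> = Some n" "(Some \<circ> \<omega>') \<delta> = Some m"
          by auto
        then show "compatible (shift (- \<gamma>) (decode n)) (shift (- \<delta>) (decode m))"
          unfolding \<Omega>''_def mem_Collect_eq conflict_free_def by blast
      qed
    qed
    then have "closed \<Omega>''"
      using closure_subset_eq by blast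
    moreover have "shift \<gamma> \<omega> \<in> \<Omega>''" if "\<omega> \<in> \<Omega>''" for \<gamma> \<omega>
    proof -
      have "Some \<circ> shift \<gamma> \<omega> = shift \<gamma> (Some \<circ> \<omega>)"
        by (simp add: shift_def fun_eq_iff)
      then show ?thesis
        using that conflict_free_shift[of "Some \<circ> \<omega>" \<gamma>] by (simp add: \<Omega>''_def)
    qed
    ultimately show ?thesis
      by (simp add: subshift_def)
  qed
  have Fin_eq: "Fin \<Omega>'' = {\<phi> \<in> fin_maps. conflict_free \<phi>}"
  proof (intro equalityI subsetI)
    fix \<phi> assume "\<phi> \<in> Fin \<Omega>''"
    then show "\<phi> \<in> {\<phi> \<in> fin_maps. conflict_free \<phi>}"
      by (auto simp: Fin_def \<Omega>''_def intro: conflict_free_le)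
  next
    fix \<phi> assume "\<phi> \<in> {\<phi> \<in> fin_maps. conflict_free \<phi>}"
    then show "\<phi> \<in> Fin \<Omega>''"
      using conflict_free_total_extension[of \<phi>]
      by (auto simp: Fin_def fin_maps_def \<Omega>''_def)
  qed
  \<comment> \<open>By \<open>conflict_near\<close>, labels \<open>n\<close> and \<open>m\<close> in
    conflict are within \<open>(r n + r m) / 2\<close>, so one of the two balls contains the other
    position. Invalid labels get radius \<open>0\<close>: the ball still contains their own position
    and exposes them.\<close>
  define r where "r n = (if valid n then 2 * (R (decode n) + (\<Sum>a\<in>dom (decode n). d a 0)) else 0)" for n
  have r_nonneg: "0 \<le> r n" for n
    using R_nonneg by (auto simp: r_def valid_def intro!: add_nonneg_nonneg sum_nonneg)
  have "locally_in d r (Fin \<Omega>'') \<phi> \<longleftrightarrow> conflict_free \<phi>" if fin: "\<phi> \<in> fin_maps" for \<phi>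
  proof
    assume "conflict_free \<phi>"
    then have "conflict_free (\<phi> |` S)" for S
      by (rule conflict_free_le) (simp add: map_le_def)
    moreover have "\<phi> |` S \<in> fin_maps" for S
      using fin by (auto simp: fin_maps_def)
    ultimately show "locally_in d r (Fin \<Omega>'') \<phi>"
      by (simp add: locally_in_def Fin_eq)
  next
    assume loc: "locally_in d r (Fin \<Omega>'') \<phi>"
    have seen: "valid n \<and> (\<forall>\<delta> m. \<phi> \<delta> = Some m \<longrightarrow> d \<gamma> \<delta> \<le> r n \<longrightarrow>
        compatible (shift (- \<gamma>) (decode n)) (shift (- \<delta>) (decode m)))" if "\<phi> \<gamma> = Some n" for \<gamma> n
    proof -
      let ?\<phi> = "\<phi> |` (dom \<phi> \<inter> mcball \<gamma> (r n))"
      have "conflict_free ?\<phi>"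
        using loc that unfolding locally_in_def Fin_eq by force
      moreover have "?\<phi> \<gamma> = Some n"
        using that r_nonneg by (auto simp: restrict_map_def)
      moreover have "?\<phi> \<delta> = Some m" if "\<phi> \<delta> = Some m" "d \<gamma> \<delta> \<le> r n" for \<delta> m
        using that by (auto simp: restrict_map_def)
      ultimately show ?thesis
        unfolding conflict_free_def by blast
    qed
    show "conflict_free \<phi>"
      unfolding conflict_free_def
    proof (intro conjI allI impI)
      fix \<gamma> n \<delta> m assume *: "\<phi> \<gamma> = Some n" "\<phi> \<delta> = Some m"
      then have val: "valid n" "valid m"
        using seen by blast+
      show "compatible (shift (- \<gamma>) (decode n)) (shift (- \<delta>) (decode m))"
      proof (rule ccontr)
        assume nc: "\<not> ?thesis"
        from conflict_near[OF val nc] have "d \<gamma> \<delta> \<le> r n \<or> d \<delta> \<gamma> \<le> r m"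
          using val by (auto simp: r_def commute[of \<delta>])
        then show False
        proof
          assume "d \<delta> \<gamma> \<le> r m"
          then have "compatible (shift (- \<delta>) (decode m)) (shift (- \<gamma>) (decode n))"
            using seen * by blast
          then show False
            using nc val compatible_sym by (auto simp: valid_def intro: Fin_shift')
        qed (use seen * nc in blast)
      qed
    qed (use seen in blast)
  qed
  then have "subshift_local d \<Omega>''"
    unfolding subshift_local_def local_ideal_def
    by (intro exI[of _ r]) (auto simp: r_nonneg Fin_eq)
  \<comment> \<open>The reduction reads the decoded pattern at the identity, which is the placed
    pattern at its own position.\<close>
  moreover have "(\<lambda>n. the (decode n (0 :: 'g))) \<circ> \<omega> \<in> \<Omega>'" if "\<omega> \<in> \<Omega>''" for \<omega>
  proof (rule compatible_family_in_subshift)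
    have cf: "conflict_free (Some \<circ> \<omega>)"
      using that by (simp add: \<Omega>''_def)
    then have val: "valid (\<omega> \<gamma>)" for \<gamma>
      by (auto simp: conflict_free_def)
    show "shift (- \<gamma>) (decode (\<omega> \<gamma>)) \<in> Fin \<Omega>'" for \<gamma>
      using val[of \<gamma>] by (auto simp: valid_def intro: Fin_shift')
    show "shift (- \<gamma>) (decode (\<omega> \<gamma>)) \<gamma> = Some (((\<lambda>n. the (decode n (0 :: 'g))) \<circ> \<omega>) \<gamma>)" for \<gamma>
      using val[of \<gamma>] by (auto simp: valid_def shift_def)
    show "compatible (shift (- \<gamma>) (decode (\<omega> \<gamma>))) (shift (- \<delta>) (decode (\<omega> \<delta>)))" for \<gamma> \<delta>
      using cf by (auto simp: conflict_free_def)
  qed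
  then have "reducible_to \<Omega> \<Omega>''"
    using assms(4) unfolding reducible_to_def by blast
  ultimately show ?thesis
    using sub by blast
qed

section \<open>From the join property to colorings\<close>

text \<open>Coordinates outside a finite \<open>S\<close> are free. The value \<open>b\<close> at
  three of them destroys every nontrivial right translation symmetry of the support.\<close>

lemma free_finitely_supported_point:
  fixes a b :: "'z::topological_space" and U :: "('g::group_add \<Rightarrow> 'z) set"
  assumes inf: "infinite (UNIV :: 'g set)" and "a \<noteq> b" "open U" "U \<noteq> {}"
  shows "\<exists>x\<in>U. finite {\<gamma>. x \<gamma> \<noteq> a} \<and> (\<exists>\<gamma>. x \<gamma> \<noteq> a) \<and> (\<forall>\<delta>. shift \<delta> x = x \<longrightarrow> \<delta> = 0)"
proof -
  obtain y where "y \<in> U"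
    using assms by blast
  with \<open>open U\<close> obtain S where S: "finite S" "\<forall>y'. (\<forall>i\<in>S. y' i = y i) \<longrightarrow> y' \<in> U"
    by (rule open_fun_finite_support)
  obtain p where p: "p \<notin> S"
    using ex_new_if_finite[OF inf S(1)] by blast
  obtain q where q: "q \<notin> insert p S"
    using ex_new_if_finite[OF inf, of "insert p S"] S(1) by blast
  define T where "T = insert p (insert q S)"
  have "finite T"
    using S(1) by (simp add: T_def)
  then have "finite (T \<union> (\<lambda>(s, t, u). s - t + u) ` (T \<times> T \<times> T))"
    by simp
  \<comment> \<open>A translation that sends one point of \<open>T\<close> to \<open>c\<close> and
    another point of \<open>T\<close> into \<open>T\<close> would write \<open>c\<close> as
    \<open>s - t + u\<close>, which is excluded here.\<close>
  then obtain c where c: "c \<notin> T \<union> (\<lambda>(s, t, u). s - t + u) ` (T \<times> T \<times> T)"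
    using ex_new_if_finite[OF inf] by blast
  define x where "x \<gamma> = (if \<gamma> \<in> S then y \<gamma> else if \<gamma> \<in> {p, q, c} then b else a)" for \<gamma>
  have supp: "{\<gamma>. x \<gamma> \<noteq> a} \<subseteq> insert c T"
    by (auto simp: x_def T_def)
  have pqc: "x p \<noteq> a" "x q \<noteq> a" "x c \<noteq> a"
    using p q c \<open>a \<noteq> b\<close> by (auto simp: x_def T_def)
  have "\<delta> = 0" if "shift \<delta> x = x" for \<delta>
  proof (rule ccontr)
    assume "\<delta> \<noteq> 0"
    have inv: "x (\<gamma> + \<delta>) = x \<gamma>" for \<gamma>
      using fun_cong[OF that, of \<gamma>] by (simp add: shift_def)
    have "x (c - \<delta>) \<noteq> a"
      using inv[of "c - \<delta>"] pqc by simp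
    moreover have "c - \<delta> \<noteq> c"
    proof
      assume "c - \<delta> = c"
      then have "c + 0 = c + \<delta>"
        by (simp add: diff_eq_eq)
      then show False
        using \<open>\<delta> \<noteq> 0\<close> add_left_imp_eq[of c 0 \<delta>] by blast
    qed
    ultimately have "c - \<delta> \<in> T"
      using supp by auto
    \<comment> \<open>One of \<open>p\<close> and \<open>q\<close> differs from
      \<open>c - \<delta>\<close>; this is why two points were added besides
      \<open>c\<close>.\<close>
    obtain t where t: "t \<in> T" "x t \<noteq> a" "t \<noteq> c - \<delta>"
      using pqc q by (metis T_def insertCI)
    have "t + \<delta> \<noteq> c"
      using t(3) by auto
    moreover have "x (t + \<delta>) \<noteq> a"
      using inv t(2) by simp
    ultimately have "t + \<delta> \<in> T"
      using supp by blast
    have "c = (c - \<delta>) - t + (t + \<delta>)"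
      by (simp flip: add.assoc)
    then have "c \<in> (\<lambda>(s, t, u). s - t + u) ` (T \<times> T \<times> T)"
      using \<open>c - \<delta> \<in> T\<close> \<open>t + \<delta> \<in> T\<close> t(1) by (intro image_eqI[of _ _ "(c - \<delta>, t, t + \<delta>)"]) auto
    with c show False by blast
  qed
  moreover have "x \<in> U"
    using S(2) by (auto simp: x_def)
  moreover have "finite {\<gamma>. x \<gamma> \<noteq> a}"
    using supp \<open>finite T\<close> finite_subset by blast
  ultimately show ?thesis
    using pqc(1) by blast
qed

lemma finite_common_radius:
  assumes "finite I" "\<And>i. i \<in> I \<Longrightarrow> \<exists>\<rho>>0. P i \<rho>" "\<And>i \<rho> \<rho>' :: real. P i \<rho> \<Longrightarrow> 0 < \<rho>' \<Longrightarrow> \<rho>' \<le> \<rho> \<Longrightarrow> P i \<rho>'"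
  shows "\<exists>\<rho>>0. \<forall>i\<in>I. P i \<rho>"
  using assms(1,2)
proof (induction I rule: finite_induct)
  case empty
  show ?case by (intro exI[of _ 1]) simp
next
  case (insert i I)
  then obtain \<rho> \<rho>' where "0 < \<rho>" "P i \<rho>" "0 < \<rho>'" "\<forall>i\<in>I. P i \<rho>'"
    by (metis insertCI)
  then show ?case
    using assms(3) by (intro exI[of _ "min \<rho> \<rho>'"]) (auto intro: min.cobounded1 min.cobounded2)
qed

section \<open>Placing patterns in small balls around a dense sequence\<close>

context joinable
begin

text \<open>Failure of separation puts \<open>a + \<delta>\<close> into a ball around
  \<open>b\<close> for some \<open>a\<close> and \<open>b\<close> in the finite domains, and balls
  are finite.\<close>

lemma finite_not_separated:
  assumes "\<phi> \<in> Fin \<Omega>" "\<psi> \<in> Fin \<Omega>"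
  shows "finite {\<delta>. \<not> separated d R (shift (- \<delta>) \<phi>) \<psi>}"
proof (rule finite_subset)
  let ?N = "\<Union>a\<in>dom \<phi>. \<Union>b\<in>dom \<psi>. (\<lambda>e. - a + e) ` {e. d b e \<le> R \<phi> + R \<psi>}"
  show "{\<delta>. \<not> separated d R (shift (- \<delta>) \<phi>) \<psi>} \<subseteq> ?N"
  proof
    fix \<delta> assume "\<delta> \<in> {\<delta>. \<not> separated d R (shift (- \<delta>) \<phi>) \<psi>}"
    then obtain a b where ab: "a \<in> dom \<phi>" "b \<in> dom \<psi>" "d (a + \<delta>) b \<le> R \<phi> + R \<psi>"
      using assms by (auto simp: separated_Fin_iff Fin_shift' R_shift dom_shift not_less)
    then have "\<delta> \<in> (\<lambda>e. - a + e) ` {e. d b e \<le> R \<phi> + R \<psi>}"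
      by (intro image_eqI[of _ _ "a + \<delta>"]) (auto simp: commute[of b])
    with ab show "\<delta> \<in> ?N" by blast
  qed
  show "finite ?N"
    using assms proper_metricD(3)[OF proper] by (auto simp: finite_dom)
qed

text \<open>
  The ball \<open>ball (x n) \<rho>\<close> marks the points whose identity coordinate is the origin of a piece
  \<open>\<psi>\<close>. No point of the orbits of the \<open>x m\<close> lies on its boundary, so that membership of \<open>shift \<delta> y\<close>
  in an earlier ball is locally constant near \<open>y = x n\<close>.
\<close>

definition stage ::
    "(nat \<Rightarrow> 'g \<Rightarrow> 'z::polish_space) \<Rightarrow> 'z \<Rightarrow> (nat \<Rightarrow> ('g \<rightharpoonup> nat) \<times> real) \<Rightarrow> nat \<Rightarrow> ('g \<rightharpoonup> nat) \<times> real \<Rightarrow> bool"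
where
  "stage x a s n p \<longleftrightarrow>
     fst p \<in> Fin \<Omega> \<and> 0 \<in> dom (fst p) \<and> 0 < snd p \<and>
     (\<forall>m \<delta>. dist (x n) (shift \<delta> (x m)) \<noteq> snd p) \<and>
     (\<exists>c. \<forall>y\<in>ball (x n) (snd p). y c \<noteq> a) \<and>
     (\<forall>m<n. \<forall>\<delta>. \<forall>y\<in>ball (x n) (snd p). shift \<delta> y \<in> ball (x m) (snd (s m)) \<longrightarrow>
        separated d R (shift (- \<delta>) (fst (s m))) (fst p) \<or> shift (- \<delta>) (fst (s m)) \<subseteq>\<^sub>m fst p) \<and>
     (\<forall>\<delta>. \<delta> \<noteq> 0 \<longrightarrow> (\<forall>y\<in>ball (x n) (snd p). shift \<delta> y \<in> ball (x n) (snd p) \<longrightarrow>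
        separated d R (shift (- \<delta>) (fst p)) (fst p)))"

text \<open>Seen from \<open>shift \<gamma> y\<close>, the other piece sits at
  \<open>\<delta> - \<gamma>\<close>, so the conditions in the stage of larger index apply. The
  remaining case follows by symmetry.\<close>

lemma stage_compatible:
  assumes "stage x a s n (s n)" "stage x a s m (s m)"
    and "shift \<gamma> y \<in> ball (x n) (snd (s n))" "shift \<delta> y \<in> ball (x m) (snd (s m))"
  shows "compatible (shift (- \<gamma>) (fst (s n))) (shift (- \<delta>) (fst (s m)))"
proof -
  have le: "compatible (shift (- \<gamma>) (fst (s n))) (shift (- \<delta>) (fst (s m)))"
    if st: "stage x a s n (s n)" "stage x a s m (s m)"
      and \<gamma>: "shift \<gamma> y \<in> ball (x n) (snd (s n))" and \<delta>: "shift \<delta> y \<in> ball (x m) (snd (s m))"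
      and "m \<le> n" for n m \<gamma> \<delta>
  proof (cases "m = n \<and> \<delta> = \<gamma>")
    case True
    then show ?thesis
      by (simp add: compatible_def)
  next
    case False
    have Fin: "fst (s n) \<in> Fin \<Omega>" "fst (s m) \<in> Fin \<Omega>"
      using st by (auto simp: stage_def)
    have "shift (\<delta> - \<gamma>) (shift \<gamma> y) = shift \<delta> y"
      by (simp flip: shift_add)
    then have mem: "shift (\<delta> - \<gamma>) (shift \<gamma> y) \<in> ball (x m) (snd (s m))"
      using \<delta> by simp
    have "separated d R (shift (- (\<delta> - \<gamma>)) (fst (s m))) (fst (s n)) \<or> shift (- (\<delta> - \<gamma>)) (fst (s m)) \<subseteq>\<^sub>m fst (s n)"
    proof (cases "m = n")
      case True
      then have "\<delta> - \<gamma> \<noteq> 0"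
        using False by simp
      then show ?thesis
        using st(1) \<gamma> mem True unfolding stage_def by blast
    next
      case False
      then have "m < n"
        using \<open>m \<le> n\<close> by simp
      then show ?thesis
        using st(1) \<gamma> mem unfolding stage_def by blast
    qed
    then have "compatible (shift (- (\<delta> - \<gamma>)) (fst (s m))) (fst (s n))"
      by (auto simp: compatible_def)
    then have "compatible (fst (s n)) (shift (- (\<delta> - \<gamma>)) (fst (s m)))"
      by (rule compatible_sym[OF Fin_shift'[OF Fin(2)] Fin(1)])
    then have "compatible (shift (- \<gamma>) (fst (s n))) (shift (- \<gamma>) (shift (- (\<delta> - \<gamma>)) (fst (s m))))"
      by (rule compatible_shift[OF Fin(1) Fin_shift'[OF Fin(2)]])
    moreover have "- \<gamma> + - (\<delta> - \<gamma>) = - \<delta>"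
      by (metis add_minus_cancel diff_conv_add_uminus minus_add minus_minus)
    then have "shift (- \<gamma>) (shift (- (\<delta> - \<gamma>)) (fst (s m))) = shift (- \<delta>) (fst (s m))"
      by (simp only: shift_add[symmetric])
    ultimately show ?thesis by simp
  qed
  show ?thesis
  proof (cases "m \<le> n")
    case True
    then show ?thesis
      using le assms by blast
  next
    case False
    then have "compatible (shift (- \<delta>) (fst (s m))) (shift (- \<gamma>) (fst (s n)))"
      using le[OF assms(2,1,4,3)] by simp
    then show ?thesis
      by (rule compatible_sym[rotated -1]) (use assms(1,2) in \<open>auto simp: stage_def intro: Fin_shift'\<close>)
  qed
qed

lemma stage_exists:
  fixes x :: "nat \<Rightarrow> 'g \<Rightarrow> 'z::polish_space"
  assumes supp: "\<And>n. finite {\<gamma>. x n \<gamma> \<noteq> a}" "\<And>n. \<exists>\<gamma>. x n \<gamma> \<noteq> a"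
    and free: "\<And>n \<delta>. shift \<delta> (x n) = x n \<Longrightarrow> \<delta> = 0"
    and prev: "\<And>m. m < n \<Longrightarrow> stage x a s m (s m)"
  shows "\<exists>p. stage x a s n p"
proof -
  let ?C = "\<lambda>m. ball (x m) (snd (s m))"
  \<comment> \<open>\<open>I\<close> lists the earlier pieces visible at \<open>x n\<close>. There
    are finitely many: an earlier ball forces a value other than \<open>a\<close> at a fixed
    coordinate, and \<open>x n\<close> has finite support.\<close>
  define I where "I = {(m, \<delta>). m < n \<and> shift \<delta> (x n) \<in> ?C m}"
  define Q where "Q = (\<lambda>(m, \<delta>). shift (- \<delta>) (fst (s m))) ` I"
  have "finite {\<delta>. shift \<delta> (x n) \<in> ?C m}" if m: "m < n" for m
  proof -
    obtain c where c: "\<forall>y\<in>?C m. y c \<noteq> a"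
      using prev[OF m] by (auto simp: stage_def)
    have "{\<delta>. shift \<delta> (x n) \<in> ?C m} \<subseteq> (\<lambda>\<gamma>. - c + \<gamma>) ` {\<gamma>. x n \<gamma> \<noteq> a}"
    proof
      fix \<delta> assume "\<delta> \<in> {\<delta>. shift \<delta> (x n) \<in> ?C m}"
      then have "shift \<delta> (x n) c \<noteq> a"
        using c by blast
      then show "\<delta> \<in> (\<lambda>\<gamma>. - c + \<gamma>) ` {\<gamma>. x n \<gamma> \<noteq> a}"
        by (intro image_eqI[of _ _ "c + \<delta>"]) (auto simp: shift_def)
    qed
    then show ?thesis
      using supp(1) finite_subset by blast
  qed
  then have "finite (SIGMA m:{..<n}. {\<delta>. shift \<delta> (x n) \<in> ?C m})"
    by auto
  moreover have "I = (SIGMA m:{..<n}. {\<delta>. shift \<delta> (x n) \<in> ?C m})"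
    by (auto simp: I_def)
  ultimately have "finite Q"
    by (simp add: Q_def)
  moreover have "Q \<subseteq> Fin \<Omega>"
    using prev by (auto simp: Q_def I_def stage_def intro!: Fin_shift')
  moreover have "compatible \<phi> \<psi>" if "\<phi> \<in> Q" "\<psi> \<in> Q" for \<phi> \<psi>
    using that prev by (auto simp: Q_def I_def simp del: mem_ball intro!: stage_compatible)
  \<comment> \<open>\<open>\<psi>\<close> contains all visible pieces, so it can conflict only with
    pieces not visible at \<open>x n\<close>.\<close>
  ultimately obtain \<psi> where \<psi>: "\<psi> \<in> Fin \<Omega>" "0 \<in> dom \<psi>" "\<forall>\<phi>\<in>Q. \<phi> \<subseteq>\<^sub>m \<psi>"
    using join_compatible_extend[of Q 0] by blast
  obtain c where c: "x n c \<noteq> a"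
    using supp(2) by blast
  have "open {y :: 'g \<Rightarrow> 'z. y c \<in> - {a}}"
    using product_topology_basis'[of "{c}" "\<lambda>_. - {a}" id] by (simp add: open_Compl)
  then obtain \<rho>1 where \<rho>1: "\<rho>1 > 0" "\<forall>y\<in>ball (x n) \<rho>1. y c \<noteq> a"
    using c by (auto simp: open_contains_ball subset_iff)
  \<comment> \<open>A point outside the closed ball stays outside when \<open>x n\<close> is
    slightly perturbed.\<close>
  have push: "\<exists>\<rho>>0. \<forall>y\<in>ball (x n) \<rho>. shift \<delta> y \<notin> ball (x m) e"
    if "e < dist (x m) (shift \<delta> (x n))" for m \<delta> e
  proof -
    have "open (shift \<delta> -` (- cball (x m) e))"
      by (intro open_vimage_shift) auto
    moreover have "x n \<in> shift \<delta> -` (- cball (x m) e)"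
      using that by simp
    ultimately obtain \<rho> where \<rho>: "\<rho> > 0" "ball (x n) \<rho> \<subseteq> shift \<delta> -` (- cball (x m) e)"
      by (meson open_contains_ball)
    then have "\<forall>y\<in>ball (x n) \<rho>. shift \<delta> y \<notin> ball (x m) e"
      using ball_subset_cball[of "x m" e] by blast
    with \<rho>(1) show ?thesis by blast
  qed
  \<comment> \<open>\<open>J\<close> lists the earlier positions in conflict with
    \<open>\<psi>\<close>, finitely many by \<open>finite_not_separated\<close>. There the translate
    of \<open>x n\<close> is not in the earlier ball, nor on its boundary by the condition on radii
    in \<open>stage\<close>, so \<open>push\<close> applies.\<close>
  define J where "J = {(m, \<delta>). m < n \<and> \<not> separated d R (shift (- \<delta>) (fst (s m))) \<psi> \<and> \<not> shift (- \<delta>) (fst (s m)) \<subseteq>\<^sub>m \<psi>}"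
  have "\<exists>\<rho>2>0. \<forall>i\<in>J. \<forall>y\<in>ball (x n) \<rho>2. shift (snd i) y \<notin> ?C (fst i)"
  proof (rule finite_common_radius)
    have "J \<subseteq> (SIGMA m:{..<n}. {\<delta>. \<not> separated d R (shift (- \<delta>) (fst (s m))) \<psi>})"
      by (auto simp: J_def)
    moreover have "finite (SIGMA m:{..<n}. {\<delta>. \<not> separated d R (shift (- \<delta>) (fst (s m))) \<psi>})"
      using prev \<psi>(1) by (intro finite_SigmaI finite_not_separated) (auto simp: stage_def)
    ultimately show "finite J"
      by (rule finite_subset)
  next
    fix i assume i: "i \<in> J"
    obtain m \<delta> where i_eq: "i = (m, \<delta>)" by (cases i)
    have m: "m < n" and notQ: "shift (- \<delta>) (fst (s m)) \<notin> Q"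
      using i \<psi>(3) by (auto simp: J_def i_eq)
    have "shift \<delta> (x n) \<notin> ?C m"
      using notQ m by (force simp: Q_def I_def)
    moreover have "dist (x m) (shift \<delta> (x n)) \<noteq> snd (s m)"
      using prev[OF m] by (simp add: stage_def)
    ultimately have "snd (s m) < dist (x m) (shift \<delta> (x n))"
      by simp
    then show "\<exists>\<rho>>0. \<forall>y\<in>ball (x n) \<rho>. shift (snd i) y \<notin> ?C (fst i)"
      using push by (simp add: i_eq)
  qed auto
  then obtain \<rho>2 where \<rho>2: "\<rho>2 > 0" "\<forall>(m, \<delta>)\<in>J. \<forall>y\<in>ball (x n) \<rho>2. shift \<delta> y \<notin> ?C m"
    by force
  \<comment> \<open>\<open>D\<close> lists the nontrivial translations under which
    \<open>\<psi>\<close> collides with itself. They move \<open>x n\<close>, whose stabilizer is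
    trivial, so no point of a small enough ball returns to it under them.\<close>
  define D where "D = {\<delta>. \<not> separated d R (shift (- \<delta>) \<psi>) \<psi>} - {0}"
  have "\<exists>\<rho>3>0. \<forall>\<delta>\<in>D. \<forall>y\<in>ball (x n) \<rho>3. shift \<delta> y \<notin> ball (x n) \<rho>3"
  proof (rule finite_common_radius)
    show "finite D"
      using finite_not_separated[OF \<psi>(1) \<psi>(1)] by (simp add: D_def)
  next
    fix \<delta> assume "\<delta> \<in> D"
    then have pos: "0 < dist (x n) (shift \<delta> (x n))"
      using free[of \<delta> n] by (auto simp: D_def)
    \<comment> \<open>\<open>push\<close> asks for a radius strictly below the distance; half of it
      will do.\<close>
    let ?e = "dist (x n) (shift \<delta> (x n)) / 2"
    have "?e < dist (x n) (shift \<delta> (x n))"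
      using pos by linarith
    then obtain \<rho> where "\<rho> > 0" "\<forall>y\<in>ball (x n) \<rho>. shift \<delta> y \<notin> ball (x n) ?e"
      using push by blast
    then show "\<exists>\<rho>>0. \<forall>y\<in>ball (x n) \<rho>. shift \<delta> y \<notin> ball (x n) \<rho>"
      using pos by (intro exI[of _ "min \<rho> ?e"]) auto
  next
    fix \<delta> and \<rho> \<rho>' :: real
    assume *: "\<forall>y\<in>ball (x n) \<rho>. shift \<delta> y \<notin> ball (x n) \<rho>" "\<rho>' \<le> \<rho>"
    then show "\<forall>y\<in>ball (x n) \<rho>'. shift \<delta> y \<notin> ball (x n) \<rho>'"
      using subset_ball[OF *(2)] by blast
  qed
  then obtain \<rho>3 where \<rho>3: "\<rho>3 > 0" "\<forall>\<delta>\<in>D. \<forall>y\<in>ball (x n) \<rho>3. shift \<delta> y \<notin> ball (x n) \<rho>3"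
    by blast
  let ?\<rho> = "min \<rho>1 (min \<rho>2 \<rho>3)"
  \<comment> \<open>Distances from \<open>x n\<close> to the orbits of the sequence exclude only
    countably many radii.\<close>
  have "uncountable {0<..<?\<rho>}"
    using \<rho>1(1) \<rho>2(1) \<rho>3(1) by (simp add: uncountable_open_interval)
  moreover have "countable ((\<lambda>(m, \<delta>). dist (x n) (shift \<delta> (x m))) ` UNIV)"
    by blast
  ultimately obtain \<rho> where \<rho>: "\<rho> \<in> {0<..<?\<rho>}" "\<rho> \<notin> (\<lambda>(m, \<delta>). dist (x n) (shift \<delta> (x m))) ` UNIV"
    by (meson countable_subset subsetI)
  have sub: "ball (x n) \<rho> \<subseteq> ball (x n) \<rho>1" "ball (x n) \<rho> \<subseteq> ball (x n) \<rho>2" "ball (x n) \<rho> \<subseteq> ball (x n) \<rho>3"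
    using \<rho>(1) by (auto intro!: subset_ball)
  have "stage x a s n (\<psi>, \<rho>)"
    unfolding stage_def fst_conv snd_conv
  proof (intro conjI allI impI ballI)
    fix m \<delta>
    show "dist (x n) (shift \<delta> (x m)) \<noteq> \<rho>"
      using \<rho>(2) by force
  next
    show "\<exists>c. \<forall>y\<in>ball (x n) \<rho>. y c \<noteq> a"
      using \<rho>1(2) sub by blast
  next
    fix m \<delta> y assume "m < n" "y \<in> ball (x n) \<rho>" "shift \<delta> y \<in> ?C m"
    then have "(m, \<delta>) \<notin> J"
      using \<rho>2(2) sub by blast
    then show "separated d R (shift (- \<delta>) (fst (s m))) \<psi> \<or> shift (- \<delta>) (fst (s m)) \<subseteq>\<^sub>m \<psi>"
      using \<open>m < n\<close> by (auto simp: J_def)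
  next
    fix \<delta> :: 'g and y assume "\<delta> \<noteq> 0" "y \<in> ball (x n) \<rho>" "shift \<delta> y \<in> ball (x n) \<rho>"
    then have "\<delta> \<notin> D"
      using \<rho>3(2) sub by blast
    then show "separated d R (shift (- \<delta>) \<psi>) \<psi>"
      using \<open>\<delta> \<noteq> 0\<close> by (simp add: D_def)
  qed (use \<psi> \<rho> in auto)
  then show ?thesis ..
qed

lemma coloring_exists:
  fixes a b :: "'z::polish_space"
  assumes inf: "infinite (UNIV :: 'g set)" and "a \<noteq> b"
  shows "\<exists>f. baire_measurable_coloring (shift :: 'g \<Rightarrow> ('g \<Rightarrow> 'z) \<Rightarrow> 'g \<Rightarrow> 'z) \<Omega> f"
proof -
  obtain \<B> :: "('g \<Rightarrow> 'z) set set" where \<B>: "countable \<B>" "topological_basis \<B>"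
    using ex_countable_basis by blast
  \<comment> \<open>The empty set is removed so that every \<open>?B n\<close> contains a point; the
    rest is nonempty, so \<open>from_nat_into\<close> enumerates it.\<close>
  let ?B = "from_nat_into (\<B> - {{}})"
  have "\<B> - {{}} \<noteq> {}"
  proof -
    obtain B where "B \<in> \<B>" "(\<lambda>_. a) \<in> B"
      using topological_basisE[OF \<B>(2) open_UNIV] by (metis UNIV_I)
    then show ?thesis by blast
  qed
  then have B: "?B n \<in> \<B>" "?B n \<noteq> {}" for n
    using from_nat_into[of "\<B> - {{}}" n] by auto
  have "\<exists>x\<in>?B n. finite {\<gamma>. x \<gamma> \<noteq> a} \<and> (\<exists>\<gamma>. x \<gamma> \<noteq> a) \<and> (\<forall>\<delta>. shift \<delta> x = x \<longrightarrow> \<delta> = 0)" for n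
    using B topological_basis_open[OF \<B>(2)] assms by (intro free_finitely_supported_point) auto
  then obtain x where x: "\<And>n. x n \<in> ?B n" "\<And>n. finite {\<gamma>. x n \<gamma> \<noteq> a}" "\<And>n. \<exists>\<gamma>. x n \<gamma> \<noteq> a"
      "\<And>n \<delta>. shift \<delta> (x n) = x n \<Longrightarrow> \<delta> = 0"
    by metis
  \<comment> \<open>Stages are chosen by recursion, as \<open>stage\<close> at \<open>n\<close>
    consults \<open>s\<close> only below \<open>n\<close>.\<close>
  have "\<exists>s. \<forall>n. stage x a s n (s n)"
  proof (rule dependent_wf_choice[where R = less_than])
    fix s t :: "nat \<Rightarrow> ('g \<rightharpoonup> nat) \<times> real" and n p
    assume "\<And>m. (m, n) \<in> less_than \<Longrightarrow> s m = t m"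
    then show "stage x a s n p = stage x a t n p"
      unfolding stage_def by simp
  next
    fix n and s :: "nat \<Rightarrow> ('g \<rightharpoonup> nat) \<times> real"
    assume "\<And>m. (m, n) \<in> less_than \<Longrightarrow> stage x a s m (s m)"
    then show "\<exists>p. stage x a s n p"
      using x by (intro stage_exists) auto
  qed simp
  then obtain s where s: "\<And>n. stage x a s n (s n)"
    by blast
  let ?C = "\<lambda>n. ball (x n) (snd (s n))"
  have Fin: "fst (s n) \<in> Fin \<Omega>" "0 \<in> dom (fst (s n))" "0 < snd (s n)" for n
    using s[of n] by (auto simp: stage_def)
  \<comment> \<open>\<open>W\<close> is dense because it contains every \<open>x n\<close>, and the
    \<open>x n\<close> meet all nonempty basic open sets.\<close>
  define W where "W = (\<Union>n. ?C n)"
  have "open W"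
    by (auto simp: W_def)
  moreover have "closure W = UNIV"
  proof (rule ccontr)
    assume "closure W \<noteq> UNIV"
    then obtain y where "y \<in> - closure W" by blast
    moreover have "open (- closure W)"
      by (intro open_Compl closed_closure)
    ultimately obtain B' where B': "B' \<in> \<B>" "y \<in> B'" "B' \<subseteq> - closure W"
      using topological_basisE[OF \<B>(2)] by metis
    then have "B' \<in> \<B> - {{}}"
      by blast
    then obtain n where "?B n = B'"
      using from_nat_into_surj[OF countable_Diff[OF \<B>(1)]] by blast
    then have "x n \<in> - closure W"
      using x(1)[of n] B'(3) by blast
    moreover have "x n \<in> W"
      using Fin(3)[of n] unfolding W_def by (intro UN_I[of n]) auto
    ultimately show False
      using closure_subset by blast
  qed
  ultimately have meager: "meager (- W)"
    by (rule meager_closed_dense_complement)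
  \<comment> \<open>Off \<open>W\<close> the index, and with it \<open>f\<close>, is arbitrary; this
    concerns a meager set.\<close>
  define N where "N y = (SOME n. y \<in> ?C n)" for y
  define f where "f y = the (fst (s (N y)) 0)" for y
  have N: "y \<in> ?C (N y)" if "y \<in> W" for y
    using that unfolding N_def W_def by (metis (mono_tags, lifting) UN_E someI_ex)
  \<comment> \<open>Overlapping balls carry compatible patterns, which agree at \<open>0\<close>, so
    \<open>f\<close> is constant on each ball.\<close>
  have f_eq: "f y = the (fst (s n) 0)" if y: "y \<in> ?C n" for y n
  proof -
    have "y \<in> ?C (N y)"
      using y by (intro N) (auto simp: W_def)
    then have "compatible (shift (- 0) (fst (s (N y)))) (shift (- 0) (fst (s n)))"
      using y by (intro stage_compatible[OF s s, of 0 y]) (auto simp: shift_zero)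
    then have "compatible (fst (s (N y))) (fst (s n))"
      by (simp add: shift_zero)
    then have "fst (s (N y)) 0 = fst (s n) 0"
      using Fin by (intro compatible_agree)
    then show ?thesis
      by (simp add: f_def)
  qed
  have "baire_measurable f"
    unfolding baire_measurable_def baire_property_def
  proof (intro allI impI)
    fix V :: "nat set"
    let ?U = "\<Union>n\<in>{n. the (fst (s n) 0) \<in> V}. ?C n"
    have "y \<in> - W" if "y \<in> (f -` V - ?U) \<union> (?U - f -` V)" for y
    proof
      assume "y \<in> W"
      then obtain n where n: "y \<in> ?C n"
        by (auto simp: W_def)
      from that show False
      proof
        assume "y \<in> f -` V - ?U"
        then show False
          using n f_eq[OF n] by auto
      next
        assume "y \<in> ?U - f -` V"
        then obtain m where "y \<in> ?C m" "the (fst (s m) 0) \<in> V" "f y \<notin> V"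
          by blast
        then show False
          using f_eq[of y m] by simp
      qed
    qed
    then have "meager ((f -` V - ?U) \<union> (?U - f -` V))"
      by (intro meager_subset[OF meager]) blast
    moreover have "open ?U"
      by auto
    ultimately show "\<exists>U. open U \<and> meager ((f -` V - U) \<union> (U - f -` V))"
      by blast
  qed
  moreover have "comeager (coding_map shift f -` \<Omega>)"
    unfolding comeager_def
  proof (rule meager_subset)
    \<comment> \<open>Discarding countably many meager sets leaves the points whose whole orbit
      stays in \<open>W\<close>.\<close>
    show "meager (\<Union>\<gamma>. shift \<gamma> -` (- W))"
      by (intro meager_UN meager_vimage_shift meager) auto
    show "- (coding_map shift f -` \<Omega>) \<subseteq> (\<Union>\<gamma>. shift \<gamma> -` (- W))"
    proof (rule ccontr)
      assume "\<not> ?thesis"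
      then obtain y where "y \<in> - (coding_map shift f -` \<Omega>)" "y \<notin> (\<Union>\<gamma>. shift \<gamma> -` (- W))"
        by blast
      then have y: "coding_map shift f y \<notin> \<Omega>" "\<And>\<gamma>. shift \<gamma> y \<in> W"
        by auto
      have "coding_map shift f y \<in> \<Omega>"
      proof (rule compatible_family_in_subshift)
        \<comment> \<open>Position \<open>\<gamma>\<close> carries the pattern of a ball containing
          \<open>shift \<gamma> y\<close>, moved to \<open>\<gamma>\<close>.\<close>
        let ?\<Psi> = "\<lambda>\<gamma>. shift (- \<gamma>) (fst (s (N (shift \<gamma> y))))"
        show "?\<Psi> \<gamma> \<in> Fin \<Omega>" for \<gamma>
          by (intro Fin_shift' Fin)
        show "?\<Psi> \<gamma> \<gamma> = Some (coding_map shift f y \<gamma>)" for \<gamma>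
          using Fin(2)[of "N (shift \<gamma> y)"] by (auto simp: coding_map_def f_def shift_def[of "- \<gamma>"])
        show "compatible (?\<Psi> \<gamma>) (?\<Psi> \<delta>)" for \<gamma> \<delta>
          by (rule stage_compatible[OF s s N[OF y(2)] N[OF y(2)]])
      qed
      with y(1) show False ..
    qed
  qed
  ultimately show ?thesis
    unfolding baire_measurable_coloring_def by blast
qed

end

theorem theorem2p10:
  fixes d :: "'g::{group_add,countable} \<Rightarrow> 'g \<Rightarrow> real"
    and \<Omega> :: "('g \<Rightarrow> nat) set"
  assumes "infinite (UNIV :: 'g set)"
    and "proper_right_invariant_metric d"
    and "\<exists>a b :: 'z::polish_space. a \<noteq> b"
    and "subshift \<Omega>"
  shows "((\<exists>f. baire_measurable_coloring (shift :: 'g \<Rightarrow> ('g \<Rightarrow> 'z) \<Rightarrow> 'g \<Rightarrow> 'z) \<Omega> f) \<longleftrightarrow>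
            (\<exists>\<Omega>'. subshift \<Omega>' \<and> subshift_join_property d \<Omega>' \<and> \<Omega>' \<subseteq> \<Omega>)) \<and>
         ((\<exists>\<Omega>'. subshift \<Omega>' \<and> subshift_join_property d \<Omega>' \<and> \<Omega>' \<subseteq> \<Omega>) \<longleftrightarrow>
            (\<exists>\<Omega>'. subshift \<Omega>' \<and> subshift_local d \<Omega>' \<and> reducible_to \<Omega> \<Omega>'))"
proof (intro conjI iffI)
  assume "\<exists>f. baire_measurable_coloring (shift :: 'g \<Rightarrow> ('g \<Rightarrow> 'z) \<Rightarrow> 'g \<Rightarrow> 'z) \<Omega> f"
  then show "\<exists>\<Omega>'. subshift \<Omega>' \<and> subshift_join_property d \<Omega>' \<and> \<Omega>' \<subseteq> \<Omega>"
    using coloring_imp_join assms(2,4) by blast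
next
  assume "\<exists>\<Omega>'. subshift \<Omega>' \<and> subshift_join_property d \<Omega>' \<and> \<Omega>' \<subseteq> \<Omega>"
  then obtain \<Omega>' where \<Omega>': "subshift \<Omega>'" "subshift_join_property d \<Omega>'" "\<Omega>' \<subseteq> \<Omega>"
    by blast
  then obtain R where "joinable d \<Omega>' R"
    using subshift_join_propertyE assms(2) by blast
  then obtain f :: "('g \<Rightarrow> 'z) \<Rightarrow> nat" where "baire_measurable_coloring shift \<Omega>' f"
    using joinable.coloring_exists assms(1,3) by blast
  then have "baire_measurable_coloring shift \<Omega> f"
    using \<Omega>'(3) unfolding baire_measurable_coloring_def comeager_def
    by (auto elim!: meager_subset)
  then show "\<exists>f. baire_measurable_coloring (shift :: 'g \<Rightarrow> ('g \<Rightarrow> 'z) \<Rightarrow> 'g \<Rightarrow> 'z) \<Omega> f"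
    by blast
next
  assume "\<exists>\<Omega>'. subshift \<Omega>' \<and> subshift_join_property d \<Omega>' \<and> \<Omega>' \<subseteq> \<Omega>"
  then show "\<exists>\<Omega>'. subshift \<Omega>' \<and> subshift_local d \<Omega>' \<and> reducible_to \<Omega> \<Omega>'"
    using join_imp_local[OF assms(2)] by blast
next
  assume "\<exists>\<Omega>'. subshift \<Omega>' \<and> subshift_local d \<Omega>' \<and> reducible_to \<Omega> \<Omega>'"
  then show "\<exists>\<Omega>'. subshift \<Omega>' \<and> subshift_join_property d \<Omega>' \<and> \<Omega>' \<subseteq> \<Omega>"
    using local_imp_join[OF assms(2,4)] by blast
qed

end
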